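(* Let $n\in\mathbb{N}$ and $0<\varepsilon\le\frac14$ satisfy $8\mid\varepsilon n$. In the $3$-dimensional Johnson complex $X_{\varepsilon,n}$, every vertex link (a $2$-dimensional complex) is a $1$-dimensional $\frac{1}{85}$-coboundary expander.
   Context: $wt$ is Hamming weight and $S_\varepsilon=\{x\in\mathbb{F}_2^n: wt(x)=\varepsilon n\}$. The $3$-dimensional Johnson complex $X_{\varepsilon,n}$ is the pure complex whose top faces are the sets $\{x,x+s_1,x+s_2,x+s_3\}$ with $x$ of even weight, $s_i\in S_\varepsilon$, and $wt(\sum_{i\in T}s_i)=\varepsilon n$ for every nonempty $T\subseteq[3]$, together with all their subsets; top faces are uniformly weighted. The link of a vertex $v$ is $\{t\setminus\{v\}: v\in t\}$ with the induced distribution. (Concretely, the link of $\mathbf 0$ has vertices the weight-$\varepsilon n$ vectors, edges the pairs whose supports intersect in $\varepsilon n/2$ coordinates, and triangles the pairwise adjacent triples whose three supports have common intersection of size $\varepsilon n/4$.) Coboundary expansion: for a complex $X$ of dimension $\ge2$ and a group $\Gamma$, $C^0(X,\Gamma)$ = functions $X(0)\to\Gamma$; $C^1(X,\Gamma)$ = functions $f$ on directed edges with $f(u,v)=f(v,u)^{-1}$; $C^2(X,\Gamma)$ = functions on directed triangles that are inverted by odd permutations. $\delta_0h(vu)=h(v)h(u)^{-1}$, $\delta_1h(vuw)=h(vu)h(uw)h(wv)$. $\mathrm{dist}(f_1,f_2)=\Pr_s[f_1(s)\ne f_2(s)]$ over directed $i$-faces $s$ drawn from the complex's distribution, $\mathrm{wt}(f)=\mathrm{dist}(f,\mathrm{Id})$.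 $X$ is a $1$-dimensional $\beta$-coboundary expander if for every group $\Gamma$ and $f\in C^1(X,\Gamma)$ there is $g\in C^0(X,\Gamma)$ with $\beta\,\mathrm{dist}(f,\delta_0g)\le\mathrm{wt}(\delta_1f)$. *)

theory Defs
  imports
    "HOL-Probability.Probability_Mass_Function"
    "HOL-Algebra.Group"
    "HOL-Library.Z2"
    "HOL-Library.Function_Algebras"
begin

text \<open>
  A pure weighted complex is represented by the distribution of its top faces: the top faces are
  the support of the distribution, and the faces are all their subsets.
\<close>

type_synonym 'v weighted_complex = "'v set pmf"

definition faces :: "'v weighted_complex \<Rightarrow> 'v set set" where
  "faces X = {s. \<exists>t\<in>set_pmf X. s \<subseteq> t}"

definition vertices :: "'v weighted_complex \<Rightarrow> 'v set" where
  "vertices X = {v. {v} \<in> faces X}"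

text \<open>Conditioning on the top face containing \<open>v\<close> is meaningful only for vertices \<open>v\<close> of \<open>X\<close>.\<close>

definition link :: "'v weighted_complex \<Rightarrow> 'v \<Rightarrow> 'v weighted_complex" where
  "link X v = map_pmf (\<lambda>t. t - {v}) (cond_pmf X {t. v \<in> t})"

lemma faces_link:
  assumes "v \<in> vertices X"
  shows "faces (link X v) = {t - {v} |t. t \<in> faces X \<and> v \<in> t}"
proof -
  have ne: "set_pmf X \<inter> {t. v \<in> t} \<noteq> {}"
    using assms by (auto simp: vertices_def faces_def)
  show ?thesis
  proof (rule Set.set_eqI, rule iffI)
    fix s assume "s \<in> faces (link X v)"
    then obtain t where t: "t \<in> set_pmf X" "v \<in> t" "s \<subseteq> t - {v}"
      using ne by (auto simp: faces_def link_def set_cond_pmf)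
    then have "insert v s \<in> faces X" "s = insert v s - {v}"
      by (auto simp: faces_def)
    then show "s \<in> {t - {v} |t. t \<in> faces X \<and> v \<in> t}"
      by blast
  next
    fix s assume "s \<in> {t - {v} |t. t \<in> faces X \<and> v \<in> t}"
    then obtain t where t: "t \<in> set_pmf X" "v \<in> t" "s \<subseteq> t - {v}"
      by (auto simp: faces_def)
    then have "t - {v} \<in> set_pmf (link X v)"
      using ne by (auto simp: link_def set_cond_pmf)
    with t(3) show "s \<in> faces (link X v)"
      by (auto simp: faces_def)
  qed
qed

text \<open>A directed \<open>i\<close>-face is an \<open>i\<close>-face together with an ordering of its \<open>i + 1\<close> vertices.\<close>

definition directed_faces :: "'v weighted_complex \<Rightarrow> nat \<Rightarrow> 'v list set" where
  "directed_faces X i = {s. length s = i + 1 \<and> distinct s \<and> set s \<in> faces X}"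

text \<open>Draw a top face, then a uniformly random directed \<open>i\<close>-face inside it.\<close>

definition directed_face_pmf :: "'v weighted_complex \<Rightarrow> nat \<Rightarrow> 'v list pmf" where
  "directed_face_pmf X i =
     bind_pmf X (\<lambda>t. pmf_of_set {s. length s = i + 1 \<and> distinct s \<and> set s \<subseteq> t})"

definition cochains0 :: "'v weighted_complex \<Rightarrow> 'g monoid \<Rightarrow> ('v \<Rightarrow> 'g) set" where
  "cochains0 X \<Gamma> = {h. \<forall>v\<in>vertices X. h v \<in> carrier \<Gamma>}"

definition cochains1 :: "'v weighted_complex \<Rightarrow> 'g monoid \<Rightarrow> ('v list \<Rightarrow> 'g) set" where
  "cochains1 X \<Gamma> = {f. \<forall>u v. [u, v] \<in> directed_faces X 1 \<longrightarrow>
     f [u, v] \<in> carrier \<Gamma> \<and> f [u, v] = inv\<^bsub>\<Gamma>\<^esub> f [v, u]}"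

fun coboundary0 :: "'g monoid \<Rightarrow> ('v \<Rightarrow> 'g) \<Rightarrow> 'v list \<Rightarrow> 'g" where
  "coboundary0 \<Gamma> h [v, u] = h v \<otimes>\<^bsub>\<Gamma>\<^esub> inv\<^bsub>\<Gamma>\<^esub> h u"

fun coboundary1 :: "'g monoid \<Rightarrow> ('v list \<Rightarrow> 'g) \<Rightarrow> 'v list \<Rightarrow> 'g" where
  "coboundary1 \<Gamma> h [v, u, w] = h [v, u] \<otimes>\<^bsub>\<Gamma>\<^esub> h [u, w] \<otimes>\<^bsub>\<Gamma>\<^esub> h [w, v]"

text \<open>
  Cochains are total functions on lists whose values off the directed faces carry no meaning, so
  the event is restricted to the directed faces. If every top face has at least \<open>i + 1\<close> vertices,
  these contain the support of the distribution and the restriction changes nothing.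
\<close>

definition cochain_dist ::
    "'v weighted_complex \<Rightarrow> nat \<Rightarrow> ('v list \<Rightarrow> 'g) \<Rightarrow> ('v list \<Rightarrow> 'g) \<Rightarrow> real" where
  "cochain_dist X i f1 f2 =
     measure_pmf.prob (directed_face_pmf X i) {s \<in> directed_faces X i. f1 s \<noteq> f2 s}"

definition cochain_wt ::
    "'v weighted_complex \<Rightarrow> nat \<Rightarrow> 'g monoid \<Rightarrow> ('v list \<Rightarrow> 'g) \<Rightarrow> real" where
  "cochain_wt X i \<Gamma> f = cochain_dist X i f (\<lambda>_. \<one>\<^bsub>\<Gamma>\<^esub>)"

text \<open>
  A definition cannot quantify over types; the type argument says where the elements of the
  coefficient groups live, and a statement with a free type variable there covers every group.
\<close>

definition coboundary_expander1 :: "'g itself \<Rightarrow> real \<Rightarrow> 'v weighted_complex \<Rightarrow> bool" where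
  "coboundary_expander1 ty \<beta> X \<longleftrightarrow>
     (\<forall>\<Gamma> :: 'g monoid. group \<Gamma> \<longrightarrow>
        (\<forall>f\<in>cochains1 X \<Gamma>. \<exists>g\<in>cochains0 X \<Gamma>.
           \<beta> * cochain_dist X 1 f (coboundary0 \<Gamma> g) \<le> cochain_wt X 2 \<Gamma> (coboundary1 \<Gamma> f)))"

text \<open>\<open>\<bbbF>\<^sub>2\<^sup>n\<close>, with vectors extended by zero beyond the first \<open>n\<close> coordinates; addition is pointwise.\<close>

definition F2 :: "nat \<Rightarrow> (nat \<Rightarrow> bit) set" where
  "F2 n = {x. \<forall>i\<ge>n. x i = 0}"

definition hamming_wt :: "(nat \<Rightarrow> bit) \<Rightarrow> nat" where
  "hamming_wt x = card {i. x i \<noteq> 0}"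

definition slice :: "real \<Rightarrow> nat \<Rightarrow> (nat \<Rightarrow> bit) set" where
  "slice \<epsilon> n = {x \<in> F2 n. real (hamming_wt x) = \<epsilon> * real n}"

definition johnson_top_faces :: "real \<Rightarrow> nat \<Rightarrow> (nat \<Rightarrow> bit) set set" where
  "johnson_top_faces \<epsilon> n =
     {{x, x + s 1, x + s 2, x + s 3} |x (s :: nat \<Rightarrow> nat \<Rightarrow> bit).
        x \<in> F2 n \<and> even (hamming_wt x) \<and> (\<forall>i\<in>{1..3}. s i \<in> slice \<epsilon> n) \<and>
        (\<forall>T. T \<subseteq> {1..3} \<and> T \<noteq> {} \<longrightarrow> real (hamming_wt (\<Sum>i\<in>T. s i)) = \<epsilon> * real n)}"

lemma finite_johnson_top_faces: "finite (johnson_top_faces \<epsilon> n)"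
proof -
  have "F2 n \<subseteq> (\<lambda>A i. of_bool (i \<in> A)) ` Pow {..<n}"
  proof
    fix x assume x: "x \<in> F2 n"
    then have "x = (\<lambda>i. of_bool (i \<in> {i. x i \<noteq> 0}))"
      by (intro ext) simp
    moreover have "{i. x i \<noteq> 0} \<in> Pow {..<n}"
      using x by (auto simp: F2_def not_less[symmetric])
    ultimately show "x \<in> (\<lambda>A i. of_bool (i \<in> A)) ` Pow {..<n}"
      by (rule image_eqI)
  qed
  then have "finite (F2 n)"
    by (rule finite_subset) simp
  moreover have "t \<subseteq> F2 n" if t: "t \<in> johnson_top_faces \<epsilon> n" for t
  proof -
    obtain x s where "t = {x, x + s 1, x + s 2, x + s (3::nat)}" "x \<in> F2 n"
        "\<forall>i\<in>{1..3}. s i \<in> slice \<epsilon> n"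
      using t unfolding johnson_top_faces_def by blast
    then show ?thesis
      by (simp add: slice_def F2_def)
  qed
  ultimately show ?thesis
    by (meson PowI finite_Pow_iff finite_subset subsetI)
qed

lemma johnson_top_faces_nonempty:
  assumes "\<epsilon> \<le> 1 / 4" and m: "\<epsilon> * real n = 8 * real m"
  shows "johnson_top_faces \<epsilon> n \<noteq> {}"
proof -
  have "real (32 * m) \<le> real n"
    using mult_right_mono[OF assms(1), of "real n"] m by simp
  then have nm: "32 * m \<le> n"
    by linarith
  define W :: "nat set \<Rightarrow> nat set" where
    "W B = (\<lambda>(b, r). b * (2 * m) + r) ` (B \<times> {..<2 * m})" for B
  have W: "j \<in> W B \<longleftrightarrow> m > 0 \<and> j div (2 * m) \<in> B" for j B
  proof
    assume "m > 0 \<and> j div (2 * m) \<in> B"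
    then have "(j div (2 * m), j mod (2 * m)) \<in> B \<times> {..<2 * m}"
      by simp
    moreover have "j = (\<lambda>(b, r). b * (2 * m) + r) (j div (2 * m), j mod (2 * m))"
      by (simp only: prod.case div_mult_mod_eq)
    ultimately show "j \<in> W B"
      unfolding W_def by blast
  qed (auto simp: W_def)
  have "inj_on (\<lambda>(b, r). b * (2 * m) + r) (B \<times> {..<2 * m})" for B
  proof (rule inj_on_inverseI)
    fix p assume "p \<in> B \<times> {..<2 * m}"
    then show "(\<lambda>j. (j div (2 * m), j mod (2 * m))) ((\<lambda>(b, r). b * (2 * m) + r) p) = p"
      by (cases p) (simp only: prod.case mem_Times_iff prod.sel lessThan_iff
        div_mult_self3 mod_mult_self3 div_less mod_less, simp)
  qed
  then have card_W: "card (W B) = card B * (2 * m)" for B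
    unfolding W_def by (simp add: card_image card_cartesian_product)
  define B :: "nat \<Rightarrow> nat set" where
    "B i = (if i = 1 then {0, 1, 2, 3} else if i = 2 then {2, 3, 4, 5} else {1, 2, 4, 6})" for i
  define s :: "nat \<Rightarrow> nat \<Rightarrow> bit" where "s i j = of_bool (j \<in> W (B i))" for i j
  have w: "hamming_wt x = 8 * m" if "\<And>j. x j \<noteq> 0 \<longleftrightarrow> j \<in> W C" "card C = 4" for x C
  proof -
    have "{j. x j \<noteq> 0} = W C"
      using that(1) by blast
    then show ?thesis
      using that(2) by (simp add: hamming_wt_def card_W)
  qed
  have w1: "hamming_wt (s 1) = 8 * m"
    by (rule w[of _ "{0, 1, 2, 3}"]) (simp_all add: s_def B_def)
  have w2: "hamming_wt (s 2) = 8 * m"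
    by (rule w[of _ "{2, 3, 4, 5}"]) (simp_all add: s_def B_def)
  have w3: "hamming_wt (s 3) = 8 * m"
    by (rule w[of _ "{1, 2, 4, 6}"]) (simp_all add: s_def B_def)
  have w12: "hamming_wt (s 1 + s 2) = 8 * m"
    by (rule w[of _ "{0, 1, 4, 5}"]) (auto simp: s_def W B_def)
  have w13: "hamming_wt (s 1 + s 3) = 8 * m"
    by (rule w[of _ "{0, 3, 4, 6}"]) (auto simp: s_def W B_def)
  have w23: "hamming_wt (s 2 + s 3) = 8 * m"
    by (rule w[of _ "{1, 3, 5, 6}"]) (auto simp: s_def W B_def)
  have w123: "hamming_wt (s 1 + (s 2 + s 3)) = 8 * m"
    by (rule w[of _ "{0, 2, 5, 6}"]) (auto simp: s_def W B_def)
  have eq3: "{1..3} = {1, 2, 3 :: nat}"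
    by auto
  have T: "hamming_wt (\<Sum>i\<in>T. s i) = 8 * m" if "T \<subseteq> {1..3}" "T \<noteq> {}" for T
  proof -
    have "T \<in> Pow {1, 2, 3}" "T \<noteq> {}"
      using that by (auto simp: eq3)
    then have "T = {1} \<or> T = {2} \<or> T = {3} \<or> T = {1, 2} \<or> T = {1, 3} \<or> T = {2, 3} \<or> T = {1, 2, 3}"
      unfolding Pow_insert Pow_empty image_insert image_empty
      by (elim UnE insertE emptyE) (simp_all, argo+)
    then show ?thesis
      using w1 w2 w3 w12 w13 w23 w123 by auto
  qed
  have "s i \<in> F2 n" for i
  proof -
    have "s i j = 0" if "n \<le> j" for j
    proof (cases "m = 0")
      case False
      then have "16 = 32 * m div (2 * m)"
        by simp
      also have "\<dots> \<le> j div (2 * m)"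
        using that nm by (intro div_le_mono) linarith
      finally show ?thesis
        by (auto simp: s_def W B_def)
    qed (simp add: s_def W)
    then show ?thesis
      by (simp add: F2_def)
  qed
  then have "s i \<in> slice \<epsilon> n" if "i \<in> {1..3}" for i
    using T[of "{i}"] that m by (simp add: slice_def)
  moreover have "0 \<in> F2 n" "even (hamming_wt 0)"
    by (simp_all add: F2_def hamming_wt_def)
  ultimately have "{0, 0 + s 1, 0 + s 2, 0 + s 3} \<in> johnson_top_faces \<epsilon> n"
    unfolding johnson_top_faces_def using T m
    by (intro CollectI exI[of _ "0 :: nat \<Rightarrow> bit"] exI[of _ s] conjI refl ballI allI impI) simp_all
  then show ?thesis
    by blast
qed

definition johnson_complex :: "real \<Rightarrow> nat \<Rightarrow> (nat \<Rightarrow> bit) weighted_complex" where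
  "johnson_complex \<epsilon> n = pmf_of_set (johnson_top_faces \<epsilon> n)"

end

theory Submission
  imports Defs "HOL-Combinatorics.Permutations"
begin

text \<open>
  Let \<open>k = 4q\<close> be the weight. After translation, the link of a vertex is the complex of \<open>k\<close>-subsets of
  \<open>{..<n}\<close>, with edges the pairs meeting in \<open>2q\<close> points and triangles the pairwise adjacent triples with
  \<open>q\<close> common points. The symmetric group acts transitively on ordered triangles, so it suffices to
  contract the complex to a base point \<open>A\<close> by a cone of bounded area and to average the cone over
  all permutations.

  Every \<open>B\<close> is joined to \<open>A\<close> through a \<^emph>\<open>balanced\<close> common neighbour. (1) Three pairwise adjacent sets
  bound three genuine triangles with a common apex. (2) Two balanced common neighbours of \<open>A\<close> and \<open>B\<close>
  always have a further common neighbour adjacent to \<open>A\<close> and \<open>B\<close>, so the square formed by them is filled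
  by \<open>4 \<cdot> 3 = 12\<close> triangles. (3) For an edge \<open>BC\<close> there is a set adjacent to \<open>B\<close> and \<open>C\<close> that is balanced
  for both. Hence the cycle through \<open>A\<close> and the edge \<open>BC\<close> is filled by \<open>12 + 12 + 3 = 27 \<le> 85\<close> triangles.
\<close>

section \<open>Subsets with prescribed intersections\<close>

lemma subset_with_cell_cards:
  assumes "finite U" and "\<And>c. d c \<le> card {i \<in> U. \<tau> i = c}"
  obtains Z where "Z \<subseteq> U" and "\<And>c. card {i \<in> Z. \<tau> i = c} = d c"
proof -
  have "\<exists>S. S \<subseteq> {i \<in> U. \<tau> i = c} \<and> card S = d c" for c
    using assms(2) obtain_subset_with_card_n by metis
  then obtain S where S: "\<And>c. S c \<subseteq> {i \<in> U. \<tau> i = c}" "\<And>c. card (S c) = d c"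
    by metis
  have "{i \<in> (\<Union>c. S c). \<tau> i = c} = S c" for c
    using S(1) by fastforce
  then show thesis
    using S by (intro that[of "\<Union>c. S c"]) auto
qed

lemma card_sum_cells:
  fixes \<tau> :: "'a \<Rightarrow> 'c::finite"
  assumes "finite Z"
  shows "card {i \<in> Z. Q (\<tau> i)} = (\<Sum>c\<in>UNIV. if Q c then card {i \<in> Z. \<tau> i = c} else 0)"
proof -
  have "{i \<in> Z. Q (\<tau> i)} = (\<Union>c\<in>{c. Q c}. {i \<in> Z. \<tau> i = c})"
    by auto
  also have "card \<dots> = (\<Sum>c\<in>{c. Q c}. card {i \<in> Z. \<tau> i = c})"
    using assms by (subst card_UN_disjoint) auto
  also have "\<dots> = (\<Sum>c\<in>UNIV. if Q c then card {i \<in> Z. \<tau> i = c} else 0)"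
    by (simp add: sum.If_cases)
  finally show ?thesis .
qed

section \<open>Venn cells of three sets\<close>

definition cell :: "'a set \<Rightarrow> 'a set \<Rightarrow> 'a set \<Rightarrow> 'a \<Rightarrow> bool \<times> bool \<times> bool" where
  "cell A B C i = (i \<in> A, i \<in> B, i \<in> C)"

definition cell_card :: "'a set \<Rightarrow> 'a set \<Rightarrow> 'a set \<Rightarrow> 'a set \<Rightarrow> bool \<times> bool \<times> bool \<Rightarrow> nat" where
  "cell_card A B C Z c = card {i \<in> Z. cell A B C i = c}"

lemma UNIV_bool3: "(UNIV :: (bool \<times> bool \<times> bool) set) =
  {(True,True,True), (True,True,False), (True,False,True), (True,False,False),
   (False,True,True), (False,True,False), (False,False,True), (False,False,False)}"
  by auto

text \<open>Every Boolean combination of three sets is a union of Venn cells, so the cardinality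
  questions below become linear arithmetic in eight numbers. The order of the cells is the one used
  later for \<open>c1\<close>, ..., \<open>c8\<close> and \<open>x1\<close>, ...,
  \<open>x8\<close>.\<close>

lemma card_cells:
  assumes "finite Z"
  shows "card {i \<in> Z. Q (i \<in> A) (i \<in> B) (i \<in> C)} =
    (if Q True True True then cell_card A B C Z (True,True,True) else 0)
    + (if Q True True False then cell_card A B C Z (True,True,False) else 0)
    + (if Q True False True then cell_card A B C Z (True,False,True) else 0)
    + (if Q True False False then cell_card A B C Z (True,False,False) else 0)
    + (if Q False True True then cell_card A B C Z (False,True,True) else 0)
    + (if Q False True False then cell_card A B C Z (False,True,False) else 0)
    + (if Q False False True then cell_card A B C Z (False,False,True) else 0)
    + (if Q False False False then cell_card A B C Z (False,False,False) else 0)"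
proof -
  have "card {i \<in> Z. Q (i \<in> A) (i \<in> B) (i \<in> C)} = (\<Sum>d\<in>UNIV.
      if (case d of (a,b,c) \<Rightarrow> Q a b c) then cell_card A B C Z d else 0)"
    using card_sum_cells[OF assms, of "\<lambda>(a,b,c). Q a b c" "cell A B C"]
    unfolding cell_card_def by (simp add: cell_def)
  then show ?thesis
    by (simp add: UNIV_bool3)
qed

lemma card_by_cells:
  fixes A B C Z :: "'a set"
  defines "c \<equiv> cell_card A B C Z"
  assumes "finite Z"
  shows "card Z = c (True,True,True) + c (True,True,False) + c (True,False,True)
      + c (True,False,False) + c (False,True,True) + c (False,True,False)
      + c (False,False,True) + c (False,False,False)"
    and "card (Z \<inter> A) = c (True,True,True) + c (True,True,False) + c (True,False,True) + c (True,False,False)"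
    and "card (Z \<inter> B) = c (True,True,True) + c (True,True,False) + c (False,True,True) + c (False,True,False)"
    and "card (Z \<inter> C) = c (True,True,True) + c (True,False,True) + c (False,True,True) + c (False,False,True)"
    and "card (Z \<inter> A \<inter> B) = c (True,True,True) + c (True,True,False)"
    and "card (Z \<inter> A \<inter> C) = c (True,True,True) + c (True,False,True)"
    and "card (Z \<inter> B \<inter> C) = c (True,True,True) + c (False,True,True)"
    and "card (Z \<inter> A \<inter> B \<inter> C) = c (True,True,True)"
  using card_cells[OF assms(2), of "\<lambda>_ _ _. True" A B C] card_cells[OF assms(2), of "\<lambda>a b c. a" A B C]
    card_cells[OF assms(2), of "\<lambda>a b c. b" A B C] card_cells[OF assms(2), of "\<lambda>a b c. c" A B C]
    card_cells[OF assms(2), of "\<lambda>a b c. a \<and> b" A B C] card_cells[OF assms(2), of "\<lambda>a b c. a \<and> c" A B C]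
    card_cells[OF assms(2), of "\<lambda>a b c. b \<and> c" A B C]
    card_cells[OF assms(2), of "\<lambda>a b c. a \<and> b \<and> c" A B C]
  by (simp_all add: c_def Int_def)

text \<open>
  The \<open>c\<close>s are the sizes of the Venn cells of three sets, and \<open>a\<close>, \<open>b\<close> are the halves of two pairwise
  intersections. Rounding both halves up is essential: mixed rounding fails when \<open>c2 = c3 = 0\<close>.
\<close>

lemma common_balanced_cells:
  fixes q :: int
  assumes "c1 \<ge> 0" "c2 \<ge> 0" "c3 \<ge> 0" "c4 \<ge> 0" "c5 \<ge> 0" "c6 \<ge> 0" "c7 \<ge> 0"
    "c1+c2+c3+c4 = 4 * q" "c1+c2+c5+c6 = 4 * q" "c1+c3+c5+c7 = 4 * q" "c1 + c5 = 2 * q"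
    and a: "2 * a = c1 + c2 \<or> 2 * a = c1 + c2 + 1" and b: "2 * b = c1 + c3 \<or> 2 * b = c1 + c3 + 1"
  obtains x y where "0 \<le> x" "x \<le> c1" "0 \<le> a - x" "a - x \<le> c2" "0 \<le> b - x" "b - x \<le> c3"
    "0 \<le> 2 * q - a - b + x" "2 * q - a - b + x \<le> c4" "0 \<le> y" "y \<le> c5"
    "0 \<le> 2 * q - a - y" "2 * q - a - y \<le> c6" "0 \<le> 2 * q - b - y" "2 * q - b - y \<le> c7"
    "0 \<le> a + b + y - 2 * q"
proof -
  \<comment> \<open>\<open>x\<close> and \<open>y\<close> are the numbers of points to be taken from
    the cells of sizes \<open>c1\<close> and \<open>c5\<close>. All requirements are interval
    bounds: \<open>x\<close> is the largest of its lower bounds, \<open>y\<close> the smallest of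
    its upper bounds. The opposite bounds are then checked for each value at which the extremum is
    attained.\<close>
  define x where "x = max (max 0 (a - c2)) (max (b - c3) (a + b - 2 * q))"
  define y where "y = 2 * q - max c1 (max a b)"
  have c: "c5 = 2 * q - c1" "c6 = 2 * q - c2" "c7 = 2 * q - c3" "c4 = 4 * q - c1 - c2 - c3"
    using assms by linarith+
  have p: "c1 \<ge> 0" "c2 \<ge> 0" "c3 \<ge> 0" "c1 + c2 + c3 \<le> 4 * q" "c1 \<le> 2 * q" "c2 \<le> 2 * q" "c3 \<le> 2 * q"
    using assms by linarith+
  have "c1 + c2 \<le> 2 * a" "2 * a \<le> c1 + c2 + 1" "c1 + c3 \<le> 2 * b" "2 * b \<le> c1 + c3 + 1"
    using a b by linarith+
  note q = this p
  \<comment> \<open>Over the rationals only \<open>a + b - 2 * q \<le> c1 / 2 + 1\<close> follows.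
    For \<open>c1 \<ge> 1\<close> integrality turns this into the bound \<open>c1\<close>. For
    \<open>c1 = 0\<close> parity helps instead: \<open>2 * a \<le> 2 * q + 1\<close> gives
    \<open>a \<le> q\<close>, and likewise for \<open>b\<close>.\<close>
  have ab: "a + b - 2 * q \<le> c1"
  proof (cases "c1 = 0")
    case True
    then have "a \<le> q" "b \<le> q" using q by linarith+
    with True show ?thesis by simp
  next
    case False
    with q show ?thesis by linarith
  qed
  have *: "a - c2 \<le> c1" "b - c3 \<le> c1"
    "0 \<le> a" "b - c3 \<le> a" "0 \<le> b" "a - c2 \<le> b"
    "a \<le> 2 * q" "b \<le> 2 * q"
    "2 * q - b - c2 \<le> c4" "2 * q - a - c3 \<le> c4" "2 * q - a - b \<le> c4"
    "c1 - a \<le> c6" "b - a \<le> c6" "c1 - b \<le> c7" "a - b \<le> c7"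
    "c1 \<le> a + b"
    using q unfolding c by linarith+
  have x: "0 \<le> x" "a - x \<le> c2" "b - x \<le> c3" "0 \<le> 2 * q - a - b + x"
    unfolding x_def by linarith+
  have "x = 0 \<or> x = a - c2 \<or> x = b - c3 \<or> x = a + b - 2 * q"
    unfolding x_def by linarith
  then have x': "x \<le> c1" "x \<le> a" "x \<le> b" "2 * q - a - b + x \<le> c4"
    using * ab assms(1-7) by (elim disjE; linarith)+
  have y: "y \<le> c5" "0 \<le> 2 * q - a - y" "0 \<le> 2 * q - b - y"
    using c unfolding y_def by linarith+
  have "y = 2 * q - c1 \<or> y = 2 * q - a \<or> y = 2 * q - b"
    unfolding y_def by linarith
  then have y': "0 \<le> y" "2 * q - a - y \<le> c6" "2 * q - b - y \<le> c7" "0 \<le> a + b + y - 2 * q"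
    using * assms(1-7) p by (elim disjE; linarith)+
  show thesis
    using that[of x y] x x' y y' by simp
qed

text \<open>Take \<open>x\<close> points from \<open>P \<inter> P'\<close>, \<open>x\<close> points
  outside both sets, and \<open>q - x\<close> points from each of the two differences. The smallest
  \<open>x\<close> that the differences allow also fits into the other two pieces, because
  \<open>P\<close>, \<open>P'\<close> and their complements in \<open>R\<close> have at least
  \<open>q\<close> points each.\<close>

lemma halving:
  assumes "finite R" "P \<subseteq> R" "P' \<subseteq> R"
    and "q \<le> card P" "q \<le> card P'" "q \<le> card (R - P)" "q \<le> card (R - P')"
  obtains S where "S \<subseteq> R" "card S = 2 * q" "card (S \<inter> P) = q" "card (S \<inter> P') = q"
proof -
  have fin: "finite P" "finite P'"
    using assms finite_subset by auto
  have eq: "P' \<inter> (R - P) = P' - P" "P \<inter> (R - P') = P - P'" "R - P' - P = R - P - P'"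
    using assms(2,3) by auto
  have cards: "card P = card (P \<inter> P') + card (P - P')" "card P' = card (P \<inter> P') + card (P' - P)"
    "card (R - P) = card (P' - P) + card (R - P - P')" "card (R - P') = card (P - P') + card (R - P - P')"
    using card_Int_Diff[of P P'] card_Int_Diff[of P' P] card_Int_Diff[of "R - P" P']
      card_Int_Diff[of "R - P'" P] assms(1-3) fin
    by (simp_all add: Int_commute eq)
  define x where "x = max (q - card (P - P')) (q - card (P' - P))"
  have x: "x \<le> q" "x \<le> card (P \<inter> P')" "q - x \<le> card (P - P')" "q - x \<le> card (P' - P)"
    "x \<le> card (R - P - P')"
    using assms(4-7) cards unfolding x_def by linarith+
  obtain S1 S2 S3 S4 where S: "S1 \<subseteq> P \<inter> P'" "card S1 = x" "S2 \<subseteq> P - P'" "card S2 = q - x"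
    "S3 \<subseteq> P' - P" "card S3 = q - x" "S4 \<subseteq> R - P - P'" "card S4 = x"
    using x obtain_subset_with_card_n by metis
  have [simp]: "finite S1" "finite S2" "finite S3" "finite S4"
    using S fin assms(1) by (auto intro: finite_subset)
  have "S1 \<inter> S2 = {}" "(S1 \<union> S2) \<inter> S3 = {}" "(S1 \<union> S2 \<union> S3) \<inter> S4 = {}" "S1 \<inter> S3 = {}"
    using S by auto
  then have c: "card (S1 \<union> S2 \<union> S3 \<union> S4) = 2 * q" "card (S1 \<union> S2) = q" "card (S1 \<union> S3) = q"
    using S x by (simp_all add: card_Un_disjoint)
  have "(S1 \<union> S2 \<union> S3 \<union> S4) \<inter> P = S1 \<union> S2" "(S1 \<union> S2 \<union> S3 \<union> S4) \<inter> P' = S1 \<union> S3"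
    "S1 \<union> S2 \<union> S3 \<union> S4 \<subseteq> R"
    using S assms by auto
  then show thesis
    using c by (intro that[of "S1 \<union> S2 \<union> S3 \<union> S4"]) simp_all
qed

section \<open>The link of the zero vector as a complex of subsets\<close>

locale johnson_link =
  fixes n q :: nat
  assumes q_pos: "0 < q" and n_ge: "16 * q \<le> n"
begin

definition vert :: "nat set \<Rightarrow> bool" where
  "vert A \<longleftrightarrow> A \<subseteq> {..<n} \<and> card A = 4 * q"

definition adj :: "nat set \<Rightarrow> nat set \<Rightarrow> bool" where
  "adj A B \<longleftrightarrow> vert A \<and> vert B \<and> card (A \<inter> B) = 2 * q"

definition tri :: "nat set \<Rightarrow> nat set \<Rightarrow> nat set \<Rightarrow> bool" where
  "tri A B C \<longleftrightarrow> adj A B \<and> adj A C \<and> adj B C \<and> card (A \<inter> B \<inter> C) = q"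

lemma adj_commute: "adj A B \<longleftrightarrow> adj B A"
  by (auto simp: adj_def Int_commute)

lemma tri_swap: "tri A B C \<longleftrightarrow> tri B A C" "tri A B C \<longleftrightarrow> tri A C B"
  by (auto simp: tri_def adj_commute Int_ac)

lemma subset_with_cells:
  assumes "\<And>c. d c \<le> cell_card A B C {..<n} c"
  obtains Z where "Z \<subseteq> {..<n}" and "\<And>c. cell_card A B C Z c = d c"
  using subset_with_cell_cards[of "{..<n}" d "cell A B C"] assms unfolding cell_card_def
  by (metis finite_lessThan)

definition bool3_fun :: "nat \<Rightarrow> nat \<Rightarrow> nat \<Rightarrow> nat \<Rightarrow> nat \<Rightarrow> nat \<Rightarrow> nat \<Rightarrow> nat \<Rightarrow> bool \<times> bool \<times> bool \<Rightarrow> nat" where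
  "bool3_fun x1 x2 x3 x4 x5 x6 x7 x8 = (\<lambda>(a,b,c).
     if a then (if b then (if c then x1 else x2) else (if c then x3 else x4))
     else (if b then (if c then x5 else x6) else (if c then x7 else x8)))"

text \<open>Cells can be filled independently, and all intersection sizes are sums of the chosen
  numbers. The search for a new neighbour of three sets thus reduces to eight inequalities.\<close>

lemma subset_with_8_cells:
  assumes "x1 \<le> cell_card A B C {..<n} (True,True,True)"
    "x2 \<le> cell_card A B C {..<n} (True,True,False)"
    "x3 \<le> cell_card A B C {..<n} (True,False,True)"
    "x4 \<le> cell_card A B C {..<n} (True,False,False)"
    "x5 \<le> cell_card A B C {..<n} (False,True,True)"
    "x6 \<le> cell_card A B C {..<n} (False,True,False)"
    "x7 \<le> cell_card A B C {..<n} (False,False,True)"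
    "x8 \<le> cell_card A B C {..<n} (False,False,False)"
  obtains Z where "Z \<subseteq> {..<n}" and "card Z = x1+x2+x3+x4+x5+x6+x7+x8"
    "card (Z \<inter> A) = x1+x2+x3+x4" "card (Z \<inter> B) = x1+x2+x5+x6" "card (Z \<inter> C) = x1+x3+x5+x7"
    "card (Z \<inter> A \<inter> B) = x1+x2" "card (Z \<inter> A \<inter> C) = x1+x3" "card (Z \<inter> B \<inter> C) = x1+x5"
    "card (Z \<inter> A \<inter> B \<inter> C) = x1"
proof -
  have "bool3_fun x1 x2 x3 x4 x5 x6 x7 x8 c \<le> cell_card A B C {..<n} c" for c
    using assms by (cases c) (auto simp: bool3_fun_def)
  then obtain Z where Z: "Z \<subseteq> {..<n}" "\<And>c. cell_card A B C Z c = bool3_fun x1 x2 x3 x4 x5 x6 x7 x8 c"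
    using subset_with_cells by metis
  have "finite Z"
    using Z(1) finite_subset by blast
  note e = card_by_cells[OF this, where A=A and B=B and C=C]
  show thesis
    by (rule that[OF Z(1)]; unfold e Z(2); simp add: bool3_fun_def)
qed

lemma cells_of_verts:
  assumes "vert A" "vert B" "vert C"
  obtains c1 c2 c3 c4 c5 c6 c7 c8 where
    "cell_card A B C {..<n} (True,True,True) = c1"
    "cell_card A B C {..<n} (True,True,False) = c2"
    "cell_card A B C {..<n} (True,False,True) = c3"
    "cell_card A B C {..<n} (True,False,False) = c4"
    "cell_card A B C {..<n} (False,True,True) = c5"
    "cell_card A B C {..<n} (False,True,False) = c6"
    "cell_card A B C {..<n} (False,False,True) = c7"
    "cell_card A B C {..<n} (False,False,False) = c8"
    "c1+c2+c3+c4 = 4 * q" "c1+c2+c5+c6 = 4 * q" "c1+c3+c5+c7 = 4 * q"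
    "card (A \<inter> B) = c1+c2" "card (A \<inter> C) = c1+c3" "card (B \<inter> C) = c1+c5"
    "card (A \<inter> B \<inter> C) = c1" "c1+c2+c3+c4+c5+c6+c7+c8 = n"
proof -
  have *: "{..<n} \<inter> A = A" "{..<n} \<inter> B = B" "{..<n} \<inter> C = C"
    using assms by (auto simp: vert_def)
  have k: "4 * q = card A" "4 * q = card B" "4 * q = card C"
    using assms by (auto simp: vert_def)
  note e = card_by_cells[where Z="{..<n}" and A=A and B=B and C=C, unfolded *]
  show thesis
    by (rule that[OF refl refl refl refl refl refl refl refl])
      (use e k in \<open>simp_all only: finite_lessThan card_lessThan simp_thms\<close>)
qed

text \<open>Adjacency forces each cell lying in an odd number of the three sets to have size
  \<open>c1\<close>, and each cell lying in exactly two of them to have size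
  \<open>2 * q - c1\<close>. \<open>D\<close> takes \<open>x\<close> points from every odd cell and
  \<open>y\<close> from every even one, the outside included. With \<open>x + y = q\<close> all
  required intersection sizes come out right.\<close>

lemma filler_exists:
  assumes "adj A B" "adj A C" "adj B C"
  obtains D where "tri A B D" "tri A C D" "tri B C D"
proof -
  have v: "vert A" "vert B" "vert C"
    using assms by (auto simp: adj_def)
  obtain c1 c2 c3 c4 c5 c6 c7 c8 where c:
    "cell_card A B C {..<n} (True,True,True) = c1"
    "cell_card A B C {..<n} (True,True,False) = c2"
    "cell_card A B C {..<n} (True,False,True) = c3"
    "cell_card A B C {..<n} (True,False,False) = c4"
    "cell_card A B C {..<n} (False,True,True) = c5"
    "cell_card A B C {..<n} (False,True,False) = c6"
    "cell_card A B C {..<n} (False,False,True) = c7"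
    "cell_card A B C {..<n} (False,False,False) = c8"
    and e: "c1+c2+c3+c4 = 4 * q" "c1+c2+c5+c6 = 4 * q" "c1+c3+c5+c7 = 4 * q"
    "card (A \<inter> B) = c1+c2" "card (A \<inter> C) = c1+c3" "card (B \<inter> C) = c1+c5"
    "card (A \<inter> B \<inter> C) = c1" "c1+c2+c3+c4+c5+c6+c7+c8 = n"
    by (rule cells_of_verts[OF v])
  have e': "c1 + c2 = 2 * q" "c1 + c3 = 2 * q" "c1 + c5 = 2 * q"
    using e assms by (simp_all add: adj_def)
  \<comment> \<open>\<open>x\<close> is the minimum of \<open>c1\<close> and \<open>q\<close>. The
    last condition says that \<open>y\<close> is at most \<open>2 * q - c1\<close>, the size of the
    cells lying in exactly two sets.\<close>
  obtain x y where xy: "x + y = q" "x \<le> c1" "c1 \<le> q + x"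
  proof (cases "c1 \<le> q")
    case True then show ?thesis using that[of c1 "q - c1"] by simp
  next
    case False then show ?thesis using that[of q 0] e' by simp
  qed
  obtain D where D: "D \<subseteq> {..<n}" "card D = x+y+y+x+y+x+x+y"
    "card (D \<inter> A) = x+y+y+x" "card (D \<inter> B) = x+y+y+x"
    "card (D \<inter> C) = x+y+y+x"
    "card (D \<inter> A \<inter> B) = x+y" "card (D \<inter> A \<inter> C) = x+y" "card (D \<inter> B \<inter> C) = x+y"
  proof (rule subset_with_8_cells[of x A B C y y x y x x y, unfolded c])
    show "x \<le> c1" by fact
    show "y \<le> c2" "y \<le> c3" "x \<le> c4" "y \<le> c5" "x \<le> c6" "x \<le> c7" "y \<le> c8"
      using e(1-3,8) e' xy n_ge by linarith+
  qed blast
  have D': "vert D" "card (A \<inter> D) = 2 * q" "card (B \<inter> D) = 2 * q" "card (C \<inter> D) = 2 * q"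
    "card (A \<inter> B \<inter> D) = q" "card (A \<inter> C \<inter> D) = q" "card (B \<inter> C \<inter> D) = q"
    using D xy(1) by (simp_all add: vert_def Int_ac)
  show thesis
    by (rule that[of D]; simp only: tri_def adj_def D' v; use assms in \<open>simp add: adj_def\<close>)
qed

text \<open>
  With \<open>j = |A \<inter> C|\<close> and \<open>a = |A \<inter> B \<inter> C|\<close>, the condition says that \<open>B\<close> cuts both \<open>A - C\<close> and
  \<open>C - A\<close> (if \<open>j \<le> 2q\<close>), respectively both \<open>A \<inter> C\<close> and the complement of \<open>A \<union> C\<close> (otherwise), into two
  pieces of size at least \<open>q\<close>. This is exactly what is needed to apply the halving lemma in these sets.
\<close>

definition balanced :: "nat set \<Rightarrow> nat set \<Rightarrow> nat set \<Rightarrow> bool" where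
  "balanced A C B \<longleftrightarrow> adj A B \<and> adj C B \<and>
    (if card (A \<inter> C) \<le> 2 * q
     then card (A \<inter> B \<inter> C) \<le> q \<and> card (A \<inter> C) \<le> q + card (A \<inter> B \<inter> C)
     else q \<le> card (A \<inter> B \<inter> C) \<and> card (A \<inter> B \<inter> C) + q \<le> card (A \<inter> C))"

text \<open>A set that contains half of \<open>A \<inter> B\<close> and half of
  \<open>A \<inter> C\<close>, both rounded up, is balanced on either side of the threshold
  \<open>2 * q\<close>. Suitable cell sizes come from \<open>common_balanced_cells\<close>. Such a
  \<open>Z\<close> later joins both ends of an edge to the base point.\<close>

lemma common_balanced_exists:
  assumes "vert A" "adj B C"
  obtains Z where "balanced A B Z" "balanced A C Z" "adj B Z" "adj C Z"
proof -
  have v: "vert A" "vert B" "vert C"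
    using assms by (auto simp: adj_def)
  obtain c1 c2 c3 c4 c5 c6 c7 c8 where c:
    "cell_card A B C {..<n} (True,True,True) = c1"
    "cell_card A B C {..<n} (True,True,False) = c2"
    "cell_card A B C {..<n} (True,False,True) = c3"
    "cell_card A B C {..<n} (True,False,False) = c4"
    "cell_card A B C {..<n} (False,True,True) = c5"
    "cell_card A B C {..<n} (False,True,False) = c6"
    "cell_card A B C {..<n} (False,False,True) = c7"
    "cell_card A B C {..<n} (False,False,False) = c8"
    and e: "c1+c2+c3+c4 = 4 * q" "c1+c2+c5+c6 = 4 * q" "c1+c3+c5+c7 = 4 * q"
    "card (A \<inter> B) = c1+c2" "card (A \<inter> C) = c1+c3" "card (B \<inter> C) = c1+c5"
    "card (A \<inter> B \<inter> C) = c1" "c1+c2+c3+c4+c5+c6+c7+c8 = n"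
    by (rule cells_of_verts[OF v])
  define a b where "a = (card (A \<inter> B) + 1) div 2" and "b = (card (A \<inter> C) + 1) div 2"
  have "2 * a = c1 + c2 \<or> 2 * a = c1 + c2 + 1" "2 * b = c1 + c3 \<or> 2 * b = c1 + c3 + 1"
    unfolding a_def b_def e by linarith+
  then have ab: "2 * int a = int c1 + int c2 \<or> 2 * int a = int c1 + int c2 + 1"
      "2 * int b = int c1 + int c3 \<or> 2 * int b = int c1 + int c3 + 1"
    by linarith+
  have ei: "int c1 + int c2 + int c3 + int c4 = 4 * int q" "int c1 + int c2 + int c5 + int c6 = 4 * int q"
      "int c1 + int c3 + int c5 + int c7 = 4 * int q" "int c1 + int c5 = 2 * int q"
    using e(1-3,6) assms by (simp_all add: adj_def flip: of_nat_add)
  obtain x y where xy: "0 \<le> x" "x \<le> int c1" "0 \<le> int a - x" "int a - x \<le> int c2"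
    "0 \<le> int b - x" "int b - x \<le> int c3"
    "0 \<le> 2 * int q - int a - int b + x" "2 * int q - int a - int b + x \<le> int c4" "0 \<le> y" "y \<le> int c5"
    "0 \<le> 2 * int q - int a - y" "2 * int q - int a - y \<le> int c6"
    "0 \<le> 2 * int q - int b - y" "2 * int q - int b - y \<le> int c7"
    "0 \<le> int a + int b + y - 2 * int q"
    by (rule common_balanced_cells[OF _ _ _ _ _ _ _ ei ab]) auto
  \<comment> \<open>The room outside all three sets comes from \<open>n_ge\<close>.\<close>
  have x8: "int a + int b + y - 2 * int q \<le> int c8"
    using xy ei e(8) n_ge by linarith
  obtain x1 x2 x3 x4 x5 x6 x7 x8 where x: "x = int x1" "int a - x = int x2" "int b - x = int x3"
    "2 * int q - int a - int b + x = int x4" "y = int x5" "2 * int q - int a - y = int x6"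
    "2 * int q - int b - y = int x7" "int a + int b + y - 2 * int q = int x8"
    using xy zero_le_imp_eq_int by metis
  have sums: "x1+x2 = a" "x1+x3 = b" "x1+x2+x3+x4 = 2 * q" "x1+x2+x5+x6 = 2 * q" "x1+x3+x5+x7 = 2 * q"
    "x1+x2+x3+x4+x5+x6+x7+x8 = 4 * q"
    using x by linarith+
  have le: "x1 \<le> c1" "x2 \<le> c2" "x3 \<le> c3" "x4 \<le> c4" "x5 \<le> c5" "x6 \<le> c6" "x7 \<le> c7" "x8 \<le> c8"
    using xy(2,4,6,8,10,12,14) x8 x by linarith+
  obtain Z where Z: "Z \<subseteq> {..<n}" "card Z = x1+x2+x3+x4+x5+x6+x7+x8"
    "card (Z \<inter> A) = x1+x2+x3+x4" "card (Z \<inter> B) = x1+x2+x5+x6" "card (Z \<inter> C) = x1+x3+x5+x7"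
    "card (Z \<inter> A \<inter> B) = x1+x2" "card (Z \<inter> A \<inter> C) = x1+x3"
    using subset_with_8_cells[of x1 A B C x2 x3 x4 x5 x6 x7 x8, unfolded c, OF le] by metis
  note Z = Z(1) Z(2)[unfolded sums(6)] Z(3)[unfolded sums(3)] Z(4)[unfolded sums(4)]
    Z(5)[unfolded sums(5)] Z(6)[unfolded sums(1)] Z(7)[unfolded sums(2)]
  have Z': "vert Z" "card (A \<inter> Z) = 2 * q" "card (B \<inter> Z) = 2 * q" "card (C \<inter> Z) = 2 * q"
    "card (A \<inter> Z \<inter> B) = a" "card (A \<inter> Z \<inter> C) = b"
    using Z by (simp_all add: vert_def Int_ac)
  have bal: "balanced A X Z"
    if "vert X" "card (X \<inter> Z) = 2 * q" "card (A \<inter> Z \<inter> X) = (card (A \<inter> X) + 1) div 2" for X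
    using that Z' v by (auto simp: balanced_def adj_def)
  have "adj B Z" "adj C Z"
    using Z' v by (simp_all add: adj_def)
  with that[of Z] bal[of B] bal[of C] Z' v show thesis
    by (simp add: a_def b_def)
qed

text \<open>\<open>D\<close> is the union of two disjoint sets \<open>S\<close> and \<open>T\<close>
  of size \<open>2 * q\<close>, each halved by both \<open>B\<close> and \<open>B'\<close>. If
  \<open>A \<inter> C\<close> is small, \<open>S\<close> lies in \<open>A - C\<close> and
  \<open>T\<close> in \<open>C - A\<close>; if it is large, \<open>S\<close> lies in
  \<open>A \<inter> C\<close> and \<open>T\<close> outside both. Either way \<open>D\<close> meets
  \<open>A\<close> and \<open>C\<close> in exactly \<open>2 * q\<close> points.\<close>

lemma balanced_common_neighbour:
  assumes "balanced A C B" "balanced A C B'"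
  obtains D where "adj A D" "adj C D" "adj B D" "adj B' D"
proof -
  have v: "vert A" "vert C" "vert B" "vert B'"
    using assms by (auto simp: balanced_def adj_def)
  then have fin: "finite A" "finite B" "finite C" "finite B'"
    by (auto simp: vert_def intro: finite_subset)
  show thesis
  proof (cases "card (A \<inter> C) \<le> 2 * q")
    case True
    have 1: "q \<le> card (X \<inter> (A - C)) \<and> q \<le> card (A - C - X \<inter> (A - C)) \<and>
      q \<le> card (X \<inter> (C - A)) \<and> q \<le> card (C - A - X \<inter> (C - A))" if X: "balanced A C X" for X
    proof -
      have "vert X" using X by (simp add: balanced_def adj_def)
      obtain c1 c2 c3 c4 c5 c6 c7 c8 where c:
        "cell_card A X C {..<n} (True,True,True) = c1"
        "cell_card A X C {..<n} (True,True,False) = c2"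
        "cell_card A X C {..<n} (True,False,True) = c3"
        "cell_card A X C {..<n} (True,False,False) = c4"
        "cell_card A X C {..<n} (False,True,True) = c5"
        "cell_card A X C {..<n} (False,True,False) = c6"
        "cell_card A X C {..<n} (False,False,True) = c7"
        "cell_card A X C {..<n} (False,False,False) = c8"
        and e: "c1+c2+c3+c4 = 4 * q" "c1+c2+c5+c6 = 4 * q" "c1+c3+c5+c7 = 4 * q"
        "card (A \<inter> X) = c1+c2" "card (A \<inter> C) = c1+c3" "card (X \<inter> C) = c1+c5"
        "card (A \<inter> X \<inter> C) = c1" "c1+c2+c3+c4+c5+c6+c7+c8 = n"
        by (rule cells_of_verts[OF v(1) \<open>vert X\<close> v(2)])
      have "X \<inter> (A - C) = {i \<in> {..<n}. cell A X C i = (True,True,False)}"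
        "A - C - X \<inter> (A - C) = {i \<in> {..<n}. cell A X C i = (True,False,False)}"
        "X \<inter> (C - A) = {i \<in> {..<n}. cell A X C i = (False,True,True)}"
        "C - A - X \<inter> (C - A) = {i \<in> {..<n}. cell A X C i = (False,False,True)}"
        using v \<open>vert X\<close> by (auto simp: cell_def vert_def)
      then have "card (X \<inter> (A - C)) = c2" "card (A - C - X \<inter> (A - C)) = c4"
        "card (X \<inter> (C - A)) = c5" "card (C - A - X \<inter> (C - A)) = c7"
        using c by (simp_all add: cell_card_def)
      moreover have "c1 + c2 = 2 * q" "c1 + c5 = 2 * q" "c1 \<le> q" "c1 + c3 \<le> q + c1"
        using X e True by (simp_all add: balanced_def adj_def Int_commute)
      ultimately show ?thesis
        using e by linarith
    qed
    obtain S where S: "S \<subseteq> A - C" "card S = 2 * q" "card (S \<inter> (B \<inter> (A - C))) = q"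
      "card (S \<inter> (B' \<inter> (A - C))) = q"
      by (rule halving[of "A - C" "B \<inter> (A - C)" "B' \<inter> (A - C)" q])
        (use fin 1[OF assms(1)] 1[OF assms(2)] in auto)
    obtain T where T: "T \<subseteq> C - A" "card T = 2 * q" "card (T \<inter> (B \<inter> (C - A))) = q"
      "card (T \<inter> (B' \<inter> (C - A))) = q"
      by (rule halving[of "C - A" "B \<inter> (C - A)" "B' \<inter> (C - A)" q])
        (use fin 1[OF assms(1)] 1[OF assms(2)] in auto)
    have [simp]: "finite S" "finite T"
      using S T fin by (auto intro: finite_subset)
    have "S \<inter> (B \<inter> (A - C)) = S \<inter> B" "S \<inter> (B' \<inter> (A - C)) = S \<inter> B'"
      "T \<inter> (B \<inter> (C - A)) = T \<inter> B" "T \<inter> (B' \<inter> (C - A)) = T \<inter> B'"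
      using S(1) T(1) by auto
    note S = S[unfolded this] and T = T[unfolded this]
    have "A \<inter> (S \<union> T) = S" "C \<inter> (S \<union> T) = T" "S \<inter> T = {}" "S \<union> T \<subseteq> {..<n}"
      using S(1) T(1) v by (auto simp: vert_def)
    moreover have "B \<inter> (S \<union> T) = (S \<inter> B) \<union> (T \<inter> B)" "B' \<inter> (S \<union> T) = (S \<inter> B') \<union> (T \<inter> B')"
      "(S \<inter> B) \<inter> (T \<inter> B) = {}" "(S \<inter> B') \<inter> (T \<inter> B') = {}"
      using S(1) T(1) by auto
    ultimately show thesis
      using S(2-) T(2-) v by (intro that[of "S \<union> T"]) (simp_all add: adj_def vert_def card_Un_disjoint)
  next
    case False
    have 1: "q \<le> card (X \<inter> (A \<inter> C)) \<and> q \<le> card (A \<inter> C - X \<inter> (A \<inter> C)) \<and>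
      q \<le> card (X \<inter> ({..<n} - A - C)) \<and> q \<le> card ({..<n} - A - C - X \<inter> ({..<n} - A - C))"
      if X: "balanced A C X" for X
    proof -
      have "vert X" using X by (simp add: balanced_def adj_def)
      obtain c1 c2 c3 c4 c5 c6 c7 c8 where c:
        "cell_card A X C {..<n} (True,True,True) = c1"
        "cell_card A X C {..<n} (True,True,False) = c2"
        "cell_card A X C {..<n} (True,False,True) = c3"
        "cell_card A X C {..<n} (True,False,False) = c4"
        "cell_card A X C {..<n} (False,True,True) = c5"
        "cell_card A X C {..<n} (False,True,False) = c6"
        "cell_card A X C {..<n} (False,False,True) = c7"
        "cell_card A X C {..<n} (False,False,False) = c8"
        and e: "c1+c2+c3+c4 = 4 * q" "c1+c2+c5+c6 = 4 * q" "c1+c3+c5+c7 = 4 * q"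
        "card (A \<inter> X) = c1+c2" "card (A \<inter> C) = c1+c3" "card (X \<inter> C) = c1+c5"
        "card (A \<inter> X \<inter> C) = c1" "c1+c2+c3+c4+c5+c6+c7+c8 = n"
        by (rule cells_of_verts[OF v(1) \<open>vert X\<close> v(2)])
      have "X \<inter> (A \<inter> C) = {i \<in> {..<n}. cell A X C i = (True,True,True)}"
        "A \<inter> C - X \<inter> (A \<inter> C) = {i \<in> {..<n}. cell A X C i = (True,False,True)}"
        "X \<inter> ({..<n} - A - C) = {i \<in> {..<n}. cell A X C i = (False,True,False)}"
        "{..<n} - A - C - X \<inter> ({..<n} - A - C) = {i \<in> {..<n}. cell A X C i = (False,False,False)}"
        using v \<open>vert X\<close> by (auto simp: cell_def vert_def)
      then have "card (X \<inter> (A \<inter> C)) = c1" "card (A \<inter> C - X \<inter> (A \<inter> C)) = c3"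
        "card (X \<inter> ({..<n} - A - C)) = c6" "card ({..<n} - A - C - X \<inter> ({..<n} - A - C)) = c8"
        using c by (simp_all add: cell_card_def)
      \<comment> \<open>The equations force \<open>c6 = c1\<close>, so \<open>X\<close> has at least
        \<open>q\<close> points outside \<open>A \<union> C\<close>. The bound on \<open>c8\<close>
        is where \<open>n_ge\<close> enters.\<close>
      moreover have "c1 + c2 = 2 * q" "c1 + c5 = 2 * q" "q \<le> c1" "c1 + q \<le> c1 + c3"
        using X e False by (simp_all add: balanced_def adj_def Int_commute)
      ultimately show ?thesis
        using e n_ge by linarith
    qed
    obtain S where S: "S \<subseteq> A \<inter> C" "card S = 2 * q" "card (S \<inter> (B \<inter> (A \<inter> C))) = q"
      "card (S \<inter> (B' \<inter> (A \<inter> C))) = q"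
      by (rule halving[of "A \<inter> C" "B \<inter> (A \<inter> C)" "B' \<inter> (A \<inter> C)" q])
        (use fin 1[OF assms(1)] 1[OF assms(2)] in auto)
    obtain T where T: "T \<subseteq> {..<n} - A - C" "card T = 2 * q" "card (T \<inter> (B \<inter> ({..<n} - A - C))) = q"
      "card (T \<inter> (B' \<inter> ({..<n} - A - C))) = q"
      by (rule halving[of "{..<n} - A - C" "B \<inter> ({..<n} - A - C)" "B' \<inter> ({..<n} - A - C)" q])
        (use fin 1[OF assms(1)] 1[OF assms(2)] in auto)
    have [simp]: "finite S" "finite T"
      using S(1) T(1) fin by (auto intro: finite_subset)
    have "S \<inter> (B \<inter> (A \<inter> C)) = S \<inter> B" "S \<inter> (B' \<inter> (A \<inter> C)) = S \<inter> B'"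
      "T \<inter> (B \<inter> ({..<n} - A - C)) = T \<inter> B" "T \<inter> (B' \<inter> ({..<n} - A - C)) = T \<inter> B'"
      using S(1) T(1) by auto
    note S = S[unfolded this] and T = T[unfolded this]
    have "A \<inter> (S \<union> T) = S" "C \<inter> (S \<union> T) = S" "S \<inter> T = {}" "S \<union> T \<subseteq> {..<n}"
      using S(1) T(1) v by (auto simp: vert_def)
    moreover have "B \<inter> (S \<union> T) = (S \<inter> B) \<union> (T \<inter> B)" "B' \<inter> (S \<union> T) = (S \<inter> B') \<union> (T \<inter> B')"
      "(S \<inter> B) \<inter> (T \<inter> B) = {}" "(S \<inter> B') \<inter> (T \<inter> B') = {}"
      using S(1) T(1) by auto
    ultimately show thesis
      using S(2-) T(2-) v by (intro that[of "S \<union> T"]) (simp_all add: adj_def vert_def card_Un_disjoint)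
  qed
qed

end

section \<open>Filling cycles in the link\<close>

locale johnson_link_cochains = johnson_link n q + group \<Gamma>
  for n q and \<Gamma> :: "('g, 'b) monoid_scheme" (structure)
begin

definition cochain :: "(nat set \<Rightarrow> nat set \<Rightarrow> 'g) \<Rightarrow> bool" where
  "cochain F \<longleftrightarrow> (\<forall>A B. adj A B \<longrightarrow> F A B \<in> carrier \<Gamma> \<and> F A B = inv F B A)"

definition closed_on :: "(nat set \<Rightarrow> nat set \<Rightarrow> 'g) \<Rightarrow> nat set \<times> nat set \<times> nat set \<Rightarrow> bool" where
  "closed_on F = (\<lambda>(A, B, C). F A B \<otimes> F B C \<otimes> F C A = \<one>)"

text \<open>The set \<open>S\<close> of triangles is chosen before the cochain, so that it can be moved by permutations.\<close>

definition forced :: "nat \<Rightarrow> ((nat set \<Rightarrow> nat set \<Rightarrow> 'g) \<Rightarrow> bool) \<Rightarrow> bool" where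
  "forced k P \<longleftrightarrow> (\<exists>S. finite S \<and> card S \<le> k \<and> (\<forall>(A, B, C)\<in>S. tri A B C) \<and>
     (\<forall>F. cochain F \<longrightarrow> (\<forall>t\<in>S. closed_on F t) \<longrightarrow> P F))"

text \<open>Costs add because the two sets of triangles are united. This is the bookkeeping behind
  the constants 3, 12 and 27.\<close>

lemma forced_conj:
  assumes "forced k P" "forced l Q"
  shows "forced (k + l) (\<lambda>F. P F \<and> Q F)"
proof -
  from assms(1) obtain S where S: "finite S" "card S \<le> k" "\<forall>(A, B, C)\<in>S. tri A B C"
      "\<And>F. cochain F \<Longrightarrow> \<forall>t\<in>S. closed_on F t \<Longrightarrow> P F"
    unfolding forced_def by auto
  from assms(2) obtain T where T: "finite T" "card T \<le> l" "\<forall>(A, B, C)\<in>T. tri A B C"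
      "\<And>F. cochain F \<Longrightarrow> \<forall>t\<in>T. closed_on F t \<Longrightarrow> Q F"
    unfolding forced_def by auto
  have "card (S \<union> T) \<le> k + l"
    using card_Un_le[of S T] S(2) T(2) by linarith
  moreover have "\<forall>(A, B, C)\<in>S \<union> T. tri A B C"
    using S(3) T(3) by (rule ball_Un[THEN iffD2, OF conjI])
  moreover have "P F \<and> Q F" if "cochain F" "\<forall>t\<in>S \<union> T. closed_on F t" for F
    using that S(4)[of F] T(4)[of F] by simp
  ultimately show ?thesis
    unfolding forced_def using S(1) T(1) by (intro exI[of _ "S \<union> T"]) simp
qed

lemma forced_mono:
  assumes "forced k P" and "\<And>F. cochain F \<Longrightarrow> P F \<Longrightarrow> Q F"
  shows "forced k Q"
proof -
  from assms(1) obtain S where S: "finite S" "card S \<le> k" "\<forall>(A, B, C)\<in>S. tri A B C"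
      "\<And>F. cochain F \<Longrightarrow> \<forall>t\<in>S. closed_on F t \<Longrightarrow> P F"
    unfolding forced_def by auto
  with assms(2) show ?thesis
    unfolding forced_def by (intro exI[of _ S]) simp
qed

lemma cochain_carrier: "cochain F \<Longrightarrow> adj A B \<Longrightarrow> F A B \<in> carrier \<Gamma>"
  unfolding cochain_def by blast

lemma cochain_inv: "cochain F \<Longrightarrow> adj A B \<Longrightarrow> inv (F A B) = F B A"
  using adj_commute unfolding cochain_def by metis

lemma cochain_cancel:
  assumes "cochain F" "adj A B" "x \<in> carrier \<Gamma>"
  shows "F A B \<otimes> (F B A \<otimes> x) = x"
  using assms cochain_carrier[of F A B] cochain_inv[of F A B]
  by (metis inv_closed inv_inv l_inv m_assoc l_one)

text \<open>The closed triangle is stated as a rerouting of the edge from \<open>A\<close> to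
  \<open>B\<close> through \<open>D\<close>, the form in which spokes to an apex cancel
  later.\<close>

lemma forced_triangle:
  assumes "tri A B D"
  shows "forced 1 (\<lambda>F. F A B = F A D \<otimes> F D B)"
  unfolding forced_def
proof (intro exI[of _ "{(A, B, D)}"] conjI allI impI)
  fix F assume F: "cochain F" "\<forall>t\<in>{(A, B, D)}. closed_on F t"
  have adj: "adj A B" "adj B D" "adj D A" "adj A D" "adj D B"
    using assms adj_commute by (auto simp: tri_def)
  note c = adj[THEN cochain_carrier[OF F(1)]]
  have "F A B \<otimes> F B D \<otimes> F D A = \<one>"
    using F(2) by (simp add: closed_on_def)
  then have "F A B \<otimes> F B D = F A D"
    using c inv_equality[of "F A B \<otimes> F B D" "F D A"] cochain_inv[OF F(1) adj(3)] by simp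
  then show "F A B = F A D \<otimes> F D B"
    using c(1,2) cochain_inv[OF F(1) adj(2)] by (metis inv_closed r_inv m_assoc r_one)
qed (use assms in auto)

text \<open>Each of the three edges is rerouted through the apex \<open>D\<close> of
  \<open>filler_exists\<close>, and the two spokes at \<open>B\<close> cancel. The triple itself may
  have a common intersection of the wrong size and so fail to be a face.\<close>

lemma forced_graph_triangle:
  assumes "adj A B" "adj B C" "adj A C"
  shows "forced 3 (\<lambda>F. F A C = F A B \<otimes> F B C)"
proof -
  obtain D where D: "tri A B D" "tri A C D" "tri B C D"
    using filler_exists assms by metis
  have adj: "adj A D" "adj D A" "adj B D" "adj D B" "adj C D" "adj D C"
    using D adj_commute by (auto simp: tri_def)
  have "forced (1 + (1 + 1)) (\<lambda>F. F A B = F A D \<otimes> F D B \<and> F A C = F A D \<otimes> F D C \<and> F B C = F B D \<otimes> F D C)"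
    by (intro forced_conj forced_triangle D)
  then have "forced (1 + (1 + 1)) (\<lambda>F. F A C = F A B \<otimes> F B C)"
    by (rule forced_mono) (use adj in \<open>simp add: m_assoc cochain_carrier cochain_cancel\<close>)
  then show ?thesis
    by (simp add: numeral_3_eq_3)
qed

text \<open>A common neighbour \<open>D\<close> of the four corners cones the square into four graph
  triangles of cost 3 each. Along both paths from \<open>C\<close> to \<open>A\<close> the inner
  spokes cancel.\<close>

lemma forced_square:
  assumes "balanced A C B" "balanced A C B'"
  shows "forced 12 (\<lambda>F. F C B \<otimes> F B A = F C B' \<otimes> F B' A)"
proof -
  obtain D where D: "adj A D" "adj C D" "adj B D" "adj B' D"
    by (rule balanced_common_neighbour[OF assms])
  have adj: "adj D A" "adj D C" "adj D B" "adj D B'" "adj C B" "adj B A" "adj C B'" "adj B' A"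
    using D assms adj_commute by (auto simp: balanced_def)
  have "forced (3 + (3 + (3 + 3))) (\<lambda>F. F C B = F C D \<otimes> F D B \<and> F B A = F B D \<otimes> F D A \<and>
      F C B' = F C D \<otimes> F D B' \<and> F B' A = F B' D \<otimes> F D A)"
    by (intro forced_conj forced_graph_triangle D adj)
  then have "forced (3 + (3 + (3 + 3))) (\<lambda>F. F C B \<otimes> F B A = F C B' \<otimes> F B' A)"
    by (rule forced_mono) (use adj D in \<open>simp add: m_assoc cochain_carrier cochain_cancel\<close>)
  then show ?thesis
    by simp
qed

text \<open>If \<open>h X\<close> denotes the product of \<open>F\<close> along the chosen path from
  \<open>X\<close> to \<open>A\<close>, the conclusion is that \<open>F\<close> agrees with the
  coboundary of \<open>h\<close> on the edge. Both chosen paths are moved to paths through a common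
  \<open>Z\<close> at cost 12 each, their last edge cancels, and the graph triangle on
  \<open>B\<close>, \<open>Z\<close>, \<open>C\<close> costs 3.\<close>

lemma forced_edge:
  assumes "vert A" "adj B C" "balanced A B B'" "balanced A C C'"
  shows "forced 27 (\<lambda>F. F B C = (F B B' \<otimes> F B' A) \<otimes> inv (F C C' \<otimes> F C' A))"
proof -
  obtain Z where Z: "balanced A B Z" "balanced A C Z" "adj B Z" "adj C Z"
    using common_balanced_exists assms by metis
  have adj: "adj Z B" "adj Z C" "adj A Z" "adj Z A"
    using Z adj_commute by (auto simp: balanced_def)
  have "forced (12 + (12 + 3)) (\<lambda>F. F B B' \<otimes> F B' A = F B Z \<otimes> F Z A \<and>
      F C C' \<otimes> F C' A = F C Z \<otimes> F Z A \<and> F B C = F B Z \<otimes> F Z C)"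
    by (intro forced_conj forced_graph_triangle forced_square assms Z adj)
  then have "forced (12 + (12 + 3)) (\<lambda>F. F B C = (F B B' \<otimes> F B' A) \<otimes> inv (F C C' \<otimes> F C' A))"
    by (rule forced_mono)
      (use adj Z in \<open>simp add: m_assoc cochain_carrier cochain_cancel inv_mult_group cochain_inv\<close>)
  then show ?thesis
    by simp
qed

end

section \<open>Averaging over parametrisations\<close>

text \<open>Double counting: each \<open>\<psi> i\<close> parametrises the actual triangles
  \<open>E\<close> by the model triangles \<open>D\<close>. By uniformity a model triangle lands on
  a bad one for the same fraction of the \<open>i\<close> as there are bad triangles in
  \<open>E\<close>. Hence the cost, averaged over \<open>I\<close>, is at most \<open>k\<close>
  times the number of bad triangles.\<close>

lemma averaging:
  fixes \<psi> :: "'i \<Rightarrow> 's \<Rightarrow> 't"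
  assumes fin: "finite I" "I \<noteq> {}" "finite D" "finite E"
    and bij: "\<And>i. i \<in> I \<Longrightarrow> bij_betw (\<psi> i) D E"
    and unif: "\<And>s t. s \<in> D \<Longrightarrow> t \<in> E \<Longrightarrow> card {i \<in> I. \<psi> i s = t} * card E = card I"
    and S: "\<And>s. s \<in> D \<Longrightarrow> S s \<subseteq> D" "\<And>s. s \<in> D \<Longrightarrow> card (S s) \<le> k"
    and cost: "\<And>i s. i \<in> I \<Longrightarrow> s \<in> D \<Longrightarrow> cost i (\<psi> i s) \<Longrightarrow> \<exists>s'\<in>S s. bad (\<psi> i s')"
  shows "\<exists>i\<in>I. card {t \<in> E. cost i t} \<le> k * card {t \<in> E. bad t}"
proof (rule ccontr)
  let ?b = "card {t \<in> E. bad t}"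
  assume "\<not> ?thesis"
  \<comment> \<open>Integrality gives a gap of one for every \<open>i\<close>; summed over
    \<open>I\<close> it contradicts the double count.\<close>
  then have gt: "k * ?b + 1 \<le> card {t \<in> E. cost i t}" if "i \<in> I" for i
    using that by force
  obtain i0 where "i0 \<in> I" using fin by auto
  have "0 < card {t \<in> E. cost i0 t}"
    using gt[OF \<open>i0 \<in> I\<close>] by linarith
  then have "E \<noteq> {}" by auto
  then have E: "0 < card E" using fin by (simp add: card_gt_0_iff)
  have DE: "card D = card E"
    using bij[OF \<open>i0 \<in> I\<close>] by (rule bij_betw_same_card)
  have mem: "\<psi> i s \<in> E" if "i \<in> I" "s \<in> D" for i s
    using bij[OF that(1)] that(2) by (rule bij_betwE[rule_format])
  have bad: "card {i \<in> I. bad (\<psi> i s)} * card E = ?b * card I" if s: "s \<in> D" for s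
  proof -
    have "{i \<in> I. bad (\<psi> i s)} = (\<Union>t\<in>{t \<in> E. bad t}. {i \<in> I. \<psi> i s = t})"
      using mem s by auto
    also have "card \<dots> = (\<Sum>t\<in>{t \<in> E. bad t}. card {i \<in> I. \<psi> i s = t})"
      using fin by (subst card_UN_disjoint) auto
    finally show ?thesis
      using s unif by (simp add: sum_distrib_right)
  qed
  have "card {t \<in> E. cost i t} \<le> (\<Sum>s\<in>D. \<Sum>s'\<in>S s. if bad (\<psi> i s') then 1 else 0)" if i: "i \<in> I" for i
  proof -
    have "{t \<in> E. cost i t} = \<psi> i ` {s \<in> D. cost i (\<psi> i s)}"
      using bij_betw_imp_surj_on[OF bij[OF i]] by blast
    then have "card {t \<in> E. cost i t} \<le> card {s \<in> D. cost i (\<psi> i s)}"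
      using fin by (simp add: card_image_le)
    also have "\<dots> = (\<Sum>s\<in>D. if cost i (\<psi> i s) then 1 else 0)"
      using fin by (simp add: sum.If_cases Int_def)
    also have "\<dots> \<le> (\<Sum>s\<in>D. \<Sum>s'\<in>S s. if bad (\<psi> i s') then 1 else 0)"
    proof (rule sum_mono)
      fix s assume s: "s \<in> D"
      have "finite (S s)" using S(1)[OF s] fin finite_subset by auto
      then show "(if cost i (\<psi> i s) then 1 else 0) \<le> (\<Sum>s'\<in>S s. if bad (\<psi> i s') then 1 else (0::nat))"
        using cost[OF i s] by (auto simp: sum.If_cases card_gt_0_iff Suc_le_eq)
    qed
    finally show ?thesis .
  qed
  then have "(\<Sum>i\<in>I. k * ?b + 1) \<le> (\<Sum>i\<in>I. \<Sum>s\<in>D. \<Sum>s'\<in>S s. if bad (\<psi> i s') then 1 else 0)"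
    using gt by (intro sum_mono) (meson le_trans)
  also have "\<dots> = (\<Sum>s\<in>D. \<Sum>s'\<in>S s. \<Sum>i\<in>I. if bad (\<psi> i s') then 1 else 0)"
    by (subst sum.swap) (intro sum.cong refl, rule sum.swap)
  also have "\<dots> = (\<Sum>s\<in>D. \<Sum>s'\<in>S s. card {i \<in> I. bad (\<psi> i s')})"
    using fin by (simp add: sum.If_cases Int_def)
  \<comment> \<open>Multiplying by \<open>card E\<close> allows the uniformity hypothesis to be
    applied without division.\<close>
  finally have "(\<Sum>i\<in>I. k * ?b + 1) * card E \<le> (\<Sum>s\<in>D. \<Sum>s'\<in>S s. card {i \<in> I. bad (\<psi> i s')}) * card E"
    by (rule mult_le_mono1)
  also have "\<dots> = (\<Sum>s\<in>D. \<Sum>s'\<in>S s. card {i \<in> I. bad (\<psi> i s')} * card E)"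
    by (simp add: sum_distrib_right)
  also have "\<dots> = (\<Sum>s\<in>D. \<Sum>s'\<in>S s. ?b * card I)"
    using S(1) bad by (intro sum.cong refl) blast
  also have "\<dots> \<le> (\<Sum>s\<in>D. k * (?b * card I))"
    using S(2) by (intro sum_mono) (simp add: mult_le_mono1)
  also have "\<dots> = card I * (k * ?b) * card E"
    using DE by simp
  finally have "card I * (k * ?b + 1) \<le> card I * (k * ?b)"
    using E by (simp add: mult_le_cancel2)
  then show False
    using fin by (simp add: card_gt_0_iff)
qed

section \<open>Uniform two-dimensional complexes and bit vectors\<close>

definition ordered_triangles :: "'v set set \<Rightarrow> 'v list set" where
  "ordered_triangles T = {s. length s = 3 \<and> distinct s \<and> set s \<in> T}"

lemma cond_pmf_pmf_of_set:
  assumes "finite T" "T \<inter> A \<noteq> {}"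
  shows "cond_pmf (pmf_of_set T) A = pmf_of_set (T \<inter> A)"
proof (rule pmf_eqI)
  have T: "T \<noteq> {}" using assms by auto
  have "set_pmf (pmf_of_set T) \<inter> A \<noteq> {}"
    using assms T by simp
  moreover have "card (T \<inter> A) > 0" "card T > 0"
    using assms T by (auto simp: card_gt_0_iff)
  ultimately show "pmf (cond_pmf (pmf_of_set T) A) x = pmf (pmf_of_set (T \<inter> A)) x" for x
    using assms T by (auto simp: pmf_cond measure_pmf_of_set indicator_def)
qed

lemma length_3_conv: "length s = 3 \<longleftrightarrow> (\<exists>a b c. s = [a, b, c])"
  by (auto simp: length_Suc_conv numeral_3_eq_3)

lemma subset_3_eq:
  assumes "card t = 3" "length s = 3" "distinct s" "set s \<subseteq> t"
  shows "set s = t"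
  using assms by (metis card.infinite card_subset_eq distinct_card zero_neq_numeral)

text \<open>The last of three points is determined by the first two, so truncation is a bijection
  between two sets of six lists and preserves uniformity.\<close>

lemma orderings_take_2:
  assumes "card t = 3"
  shows "pmf_of_set {s. length s = 2 \<and> distinct s \<and> set s \<subseteq> t} =
    map_pmf (take 2) (pmf_of_set {s. length s = 3 \<and> distinct s \<and> set s \<subseteq> t})"
proof -
  have "finite t"
    using assms by (metis card.infinite zero_neq_numeral)
  let ?O = "\<lambda>k. {s. length s = k \<and> distinct s \<and> set s \<subseteq> t}"
  have card: "card (?O 3) = 6" "card (?O 2) = 6"
    using card_lists_distinct_length_eq[of t 3] card_lists_distinct_length_eq[of t 2] assms \<open>finite t\<close>
    by (simp_all add: numeral_eq_Suc atLeastAtMostSuc_conv)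
  have fin: "finite (?O 3)" "finite (?O 2)"
    by (rule card_ge_0_finite; simp only: card; simp)+
  have ne: "?O 3 \<noteq> {}"
  proof
    assume "?O 3 = {}"
    with card(1) show False by (simp only: card.empty)
  qed
  have inj: "inj_on (take 2) (?O 3)"
  proof (rule inj_onI)
    fix s s' assume s: "s \<in> ?O 3" "s' \<in> ?O 3" "take 2 s = take 2 s'"
    obtain a b c where eq: "s = [a, b, c]"
      using s(1) length_3_conv[of s] by auto
    obtain a' b' c' where eq': "s' = [a', b', c']"
      using s(2) length_3_conv[of s'] by auto
    have "set s = set s'"
      using s subset_3_eq[OF assms] by auto
    with s show "s = s'"
      unfolding eq eq' by (auto simp: numeral_2_eq_2)
  qed
  have "take 2 ` ?O 3 \<subseteq> ?O 2"
    by (auto dest: in_set_takeD)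
  then have "take 2 ` ?O 3 = ?O 2"
    using card_image[OF inj] card fin by (intro card_subset_eq) auto
  then show ?thesis
    using map_pmf_of_set_inj[OF inj ne fin(1)] by simp
qed

lemma ordered_triangles_UN:
  assumes "\<forall>t\<in>T. card t = 3"
  shows "ordered_triangles T = (\<Union>t\<in>T. {s. length s = 3 \<and> distinct s \<and> set s \<subseteq> t})"
  using assms subset_3_eq unfolding ordered_triangles_def by blast

lemma finite_ordered_triangles:
  assumes "finite T" "\<forall>t\<in>T. card t = 3"
  shows "finite (ordered_triangles T)"
proof -
  have "finite (\<Union>T)"
    using assms by (metis card.infinite finite_Union zero_neq_numeral)
  then have "finite {s. set s \<subseteq> \<Union>T \<and> length s = 3}"
    by (rule finite_lists_length_eq)
  then show ?thesis
    by (rule rev_finite_subset) (auto simp: ordered_triangles_def)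
qed

text \<open>Every triangle has six orderings and an ordering determines its triangle, so the draw in
  two stages is uniform on a disjoint union.\<close>

lemma directed_face_pmf_2:
  assumes "finite T" "T \<noteq> {}" and T: "\<forall>t\<in>T. card t = 3"
  shows "directed_face_pmf (pmf_of_set T) 2 = pmf_of_set (ordered_triangles T)"
proof -
  have c: "card {s. length s = 3 \<and> distinct s \<and> set s \<subseteq> t} = 6" if "t \<in> T" for t
    using card_lists_distinct_length_eq[of t 3] T that card.infinite[of t]
    by (cases "finite t") (auto simp add: numeral_eq_Suc atLeastAtMostSuc_conv)
  have "pmf_of_set (ordered_triangles T) =
      bind_pmf (pmf_of_set T) (\<lambda>t. pmf_of_set {s. length s = 3 \<and> distinct s \<and> set s \<subseteq> t})"
    unfolding ordered_triangles_UN[OF T]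
  proof (rule pmf_of_set_UN[where n = 6])
    show "finite (\<Union>t\<in>T. {s. length s = 3 \<and> distinct s \<and> set s \<subseteq> t})"
      using finite_ordered_triangles[OF assms(1) T] unfolding ordered_triangles_UN[OF T] .
    show "disjoint_family_on (\<lambda>t. {s. length s = 3 \<and> distinct s \<and> set s \<subseteq> t}) T"
      unfolding disjoint_family_on_def
    proof (intro ballI impI)
      fix t u assume tu: "t \<in> T" "u \<in> T" "t \<noteq> u"
      show "{s. length s = 3 \<and> distinct s \<and> set s \<subseteq> t} \<inter> {s. length s = 3 \<and> distinct s \<and> set s \<subseteq> u} = {}"
      proof (rule equals0I)
        fix s assume "s \<in> {s. length s = 3 \<and> distinct s \<and> set s \<subseteq> t} \<inter> {s. length s = 3 \<and> distinct s \<and> set s \<subseteq> u}"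
        then have "set s = t" "set s = u"
          using subset_3_eq[of t s] subset_3_eq[of u s] T tu(1,2) by blast+
        with tu(3) show False by simp
      qed
    qed
    show "{s. length s = 3 \<and> distinct s \<and> set s \<subseteq> t} \<noteq> {}" if "t \<in> T" for t
      using c[OF that] by (metis card.empty zero_neq_numeral)
  qed (use assms c in auto)
  then show ?thesis
    by (simp add: directed_face_pmf_def)
qed

text \<open>A random directed edge is realised as the start of a random ordered triangle. Edge
  distances and triangle weights thereby become counts over the same finite set.\<close>

lemma directed_face_pmf_1:
  assumes "finite T" "T \<noteq> {}" and T: "\<forall>t\<in>T. card t = 3"
  shows "directed_face_pmf (pmf_of_set T) 1 = map_pmf (take 2) (pmf_of_set (ordered_triangles T))"
proof -
  have "directed_face_pmf (pmf_of_set T) 1 = bind_pmf (pmf_of_set T)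
      (\<lambda>t. map_pmf (take 2) (pmf_of_set {s. length s = 3 \<and> distinct s \<and> set s \<subseteq> t}))"
    unfolding directed_face_pmf_def one_add_one
  proof (intro bind_pmf_cong refl)
    fix t assume "t \<in> set_pmf (pmf_of_set T)"
    then show "pmf_of_set {s. length s = 2 \<and> distinct s \<and> set s \<subseteq> t} =
        map_pmf (take 2) (pmf_of_set {s. length s = 3 \<and> distinct s \<and> set s \<subseteq> t})"
      using assms by (intro orderings_take_2) simp
  qed
  also have "\<dots> = map_pmf (take 2) (directed_face_pmf (pmf_of_set T) 2)"
    by (simp add: directed_face_pmf_def map_bind_pmf)
  finally show ?thesis
    by (simp add: directed_face_pmf_2[OF assms])
qed

lemma ordered_triangles_nonempty:
  assumes "finite T" "T \<noteq> {}" and T: "\<forall>t\<in>T. card t = 3"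
  shows "ordered_triangles T \<noteq> {}"
proof -
  obtain t where "t \<in> T" using assms by auto
  then have "card t = 3" using T by blast
  then have "finite t"
    by (metis card.infinite zero_neq_numeral)
  then obtain s where "set s = t" "distinct s"
    using finite_distinct_list by metis
  moreover from this \<open>card t = 3\<close> have "length s = 3"
    using distinct_card by metis
  ultimately have "s \<in> ordered_triangles T"
    using \<open>t \<in> T\<close> by (simp add: ordered_triangles_def)
  then show ?thesis
    by blast
qed

lemma cochain_wt_2:
  assumes "finite T" "T \<noteq> {}" and T: "\<forall>t\<in>T. card t = 3"
  shows "cochain_wt (pmf_of_set T) 2 \<Gamma> h =
    card {s \<in> ordered_triangles T. h s \<noteq> \<one>\<^bsub>\<Gamma>\<^esub>} / card (ordered_triangles T)"
proof -
  have "ordered_triangles T \<subseteq> directed_faces (pmf_of_set T) 2"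
    using assms by (auto simp: ordered_triangles_def directed_faces_def faces_def)
  then have "ordered_triangles T \<inter> {s \<in> directed_faces (pmf_of_set T) 2. h s \<noteq> \<one>\<^bsub>\<Gamma>\<^esub>} =
      {s \<in> ordered_triangles T. h s \<noteq> \<one>\<^bsub>\<Gamma>\<^esub>}"
    by auto
  then show ?thesis
    unfolding cochain_wt_def cochain_dist_def directed_face_pmf_2[OF assms]
    using ordered_triangles_nonempty[OF assms] finite_ordered_triangles[OF assms(1) T]
    by (simp add: measure_pmf_of_set)
qed

lemma cochain_dist_1:
  assumes "finite T" "T \<noteq> {}" and T: "\<forall>t\<in>T. card t = 3"
  shows "cochain_dist (pmf_of_set T) 1 f f' =
    card {s \<in> ordered_triangles T. f (take 2 s) \<noteq> f' (take 2 s)} / card (ordered_triangles T)"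
proof -
  have "take 2 s \<in> directed_faces (pmf_of_set T) 1" if "s \<in> ordered_triangles T" for s
    using that assms by (auto simp: ordered_triangles_def directed_faces_def faces_def intro!: bexI[of _ "set s"] dest: in_set_takeD)
  then have "ordered_triangles T \<inter> take 2 -` {s \<in> directed_faces (pmf_of_set T) 1. f s \<noteq> f' s} =
      {s \<in> ordered_triangles T. f (take 2 s) \<noteq> f' (take 2 s)}"
    by auto
  then show ?thesis
    unfolding cochain_dist_def directed_face_pmf_1[OF assms]
    using ordered_triangles_nonempty[OF assms] finite_ordered_triangles[OF assms(1) T]
    by (simp add: measure_pmf_of_set)
qed

section \<open>Bit vectors and their supports\<close>

definition supp :: "(nat \<Rightarrow> bit) \<Rightarrow> nat set" where
  "supp x = {i. x i \<noteq> 0}"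

definition vec :: "nat set \<Rightarrow> nat \<Rightarrow> bit" where
  "vec A i = of_bool (i \<in> A)"

lemma supp_vec [simp]: "supp (vec A) = A"
  by (auto simp: supp_def vec_def)

lemma vec_supp [simp]: "vec (supp x) = x"
  by (rule ext) (simp add: supp_def vec_def)

lemma vec_inject [simp]: "vec A = vec B \<longleftrightarrow> A = B"
  by (metis supp_vec)

lemma bit_add_neq_0: "a + b \<noteq> (0::bit) \<longleftrightarrow> (a \<noteq> 0) \<noteq> (b \<noteq> 0)"
  by (cases a; cases b) auto

lemma supp_add: "supp (x + y) = {i. (i \<in> supp x) \<noteq> (i \<in> supp y)}"
  unfolding supp_def plus_fun_def bit_add_neq_0 by auto

lemma F2_iff: "x \<in> F2 n \<longleftrightarrow> supp x \<subseteq> {..<n}"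
  unfolding F2_def supp_def by (auto simp: subset_iff) (metis bit_not_zero_iff not_less)

lemma hamming_wt_supp: "hamming_wt x = card (supp x)"
  by (simp add: hamming_wt_def supp_def)

lemma bit_vector_add_self [simp]: "x + x = (0 :: nat \<Rightarrow> bit)"
proof
  fix i
  show "(x + x) i = 0 i"
    using bit_add_neq_0[of "x i" "x i"] by (simp only: plus_fun_apply zero_fun_apply) blast
qed

lemma bit_vector_add_cancel [simp]: "x + (x + y) = (y :: nat \<Rightarrow> bit)"
  by (simp add: add.assoc[symmetric])

text \<open>Each common point of the supports is lost twice. This allows the base of a face to move
  to another of its vertices while keeping even weight.\<close>

lemma even_hamming_wt_add:
  assumes "x \<in> F2 n" "y \<in> F2 n"
  shows "even (hamming_wt (x + y)) \<longleftrightarrow> (even (hamming_wt x) \<longleftrightarrow> even (hamming_wt y))"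
proof -
  let ?X = "supp x" and ?Y = "supp y"
  have fin: "finite ?X" "finite ?Y"
    using assms finite_subset by (auto simp: F2_iff)
  have "supp (x + y) = (?X - ?Y) \<union> (?Y - ?X)"
    by (auto simp: supp_add)
  moreover have "(?X - ?Y) \<inter> (?Y - ?X) = {}"
    by blast
  ultimately have "card (supp (x + y)) = card (?X - ?Y) + card (?Y - ?X)"
    using fin card_Un_disjoint[of "?X - ?Y" "?Y - ?X"] by simp
  moreover have "card ?X = card (?X \<inter> ?Y) + card (?X - ?Y)" "card ?Y = card (?X \<inter> ?Y) + card (?Y - ?X)"
    using card_Int_Diff[of ?X ?Y] card_Int_Diff[of ?Y ?X] fin by (simp_all add: Int_commute)
  ultimately show ?thesis
    unfolding hamming_wt_supp by presburger
qed

text \<open>For \<open>k > 0\<close> the seven listed vectors are the nonzero words of a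
  three-dimensional linear code of constant weight \<open>k\<close>.\<close>

definition code_triple :: "nat \<Rightarrow> nat \<Rightarrow> (nat \<Rightarrow> bit) \<Rightarrow> (nat \<Rightarrow> bit) \<Rightarrow> (nat \<Rightarrow> bit) \<Rightarrow> bool" where
  "code_triple n k a b c \<longleftrightarrow> a \<in> F2 n \<and> b \<in> F2 n \<and> c \<in> F2 n \<and>
     (\<forall>x\<in>{a, b, c, a + b, a + c, b + c, a + (b + c)}. hamming_wt x = k)"

lemma F2_add: "x \<in> F2 n \<Longrightarrow> y \<in> F2 n \<Longrightarrow> x + y \<in> F2 n"
  by (simp add: F2_def)

lemma code_triple_swap:
  "code_triple n k a b c \<Longrightarrow> code_triple n k b a c"
  "code_triple n k a b c \<Longrightarrow> code_triple n k a c b"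
  by (auto simp: code_triple_def ac_simps)

text \<open>The new triple spans the same code. It consists of the differences of a face after its
  base has moved from \<open>x\<close> to \<open>x + a\<close>.\<close>

lemma code_triple_shift:
  assumes "code_triple n k a b c"
  shows "code_triple n k a (a + b) (a + c)"
proof -
  have "(a + b) + (a + c) = a + (a + (b + c))"
    by (simp only: ac_simps)
  then have "(a + b) + (a + c) = b + c"
    by (simp only: bit_vector_add_cancel)
  with assms show ?thesis
    by (auto simp: code_triple_def F2_add)
qed

text \<open>The left side gives the weights of the seven sums in terms of Venn cells. A sum of two
  vectors loses twice the intersection of their supports; a sum of three loses twice each pairwise
  intersection and regains four times the triple one. This yields the sizes \<open>2 * q\<close> and
  \<open>q\<close>.\<close>

lemma four_q_cells:
  fixes c1 c2 c3 c4 c5 c6 c7 q :: nat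
  shows "c1+c2+c3+c4 = 4 * q \<and> c1+c2+c5+c6 = 4 * q \<and> c1+c3+c5+c7 = 4 * q \<and>
      c3+c4+c5+c6 = 4 * q \<and> c2+c4+c5+c7 = 4 * q \<and> c2+c3+c6+c7 = 4 * q \<and> c1+c4+c6+c7 = 4 * q
    \<longleftrightarrow> c1+c2+c3+c4 = 4 * q \<and> c1+c2+c5+c6 = 4 * q \<and> c1+c3+c5+c7 = 4 * q \<and>
      c1+c2 = 2 * q \<and> c1+c3 = 2 * q \<and> c1+c5 = 2 * q \<and> c1 = q"
  by (intro iffI conjI; elim conjE; linarith)

lemma (in johnson_link) code_triple_iff_tri:
  "code_triple n (4 * q) a b c \<longleftrightarrow> tri (supp a) (supp b) (supp c)"
proof (cases "supp a \<subseteq> {..<n} \<and> supp b \<subseteq> {..<n} \<and> supp c \<subseteq> {..<n}")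
  case True
  let ?A = "supp a" and ?B = "supp b" and ?C = "supp c"
  let ?N = "cell_card ?A ?B ?C {..<n}"
  have s: "{..<n} \<inter> ?A = ?A" "{..<n} \<inter> ?B = ?B" "{..<n} \<inter> ?C = ?C"
    using True by auto
  have "supp (a + b) = {i \<in> {..<n}. (i \<in> ?A) \<noteq> (i \<in> ?B)}"
    "supp (a + c) = {i \<in> {..<n}. (i \<in> ?A) \<noteq> (i \<in> ?C)}"
    "supp (b + c) = {i \<in> {..<n}. (i \<in> ?B) \<noteq> (i \<in> ?C)}"
    "supp (a + (b + c)) = {i \<in> {..<n}. (i \<in> ?A) \<noteq> ((i \<in> ?B) \<noteq> (i \<in> ?C))}"
    using True by (auto simp: supp_add)
  then have w: "card (supp (a + b)) = ?N (True,False,True) + ?N (True,False,False) + ?N (False,True,True) + ?N (False,True,False)"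
    "card (supp (a + c)) = ?N (True,True,False) + ?N (True,False,False) + ?N (False,True,True) + ?N (False,False,True)"
    "card (supp (b + c)) = ?N (True,True,False) + ?N (True,False,True) + ?N (False,True,False) + ?N (False,False,True)"
    "card (supp (a + (b + c))) = ?N (True,True,True) + ?N (True,False,False) + ?N (False,True,False) + ?N (False,False,True)"
    using card_cells[of "{..<n}" "\<lambda>a b c. a \<noteq> b" ?A ?B ?C] card_cells[of "{..<n}" "\<lambda>a b c. a \<noteq> c" ?A ?B ?C]
      card_cells[of "{..<n}" "\<lambda>a b c. b \<noteq> c" ?A ?B ?C] card_cells[of "{..<n}" "\<lambda>a b c. a \<noteq> (b \<noteq> c)" ?A ?B ?C]
    by simp_all
  note c = card_by_cells[where Z = "{..<n}" and A = ?A and B = ?B and C = ?C, unfolded s, OF finite_lessThan]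
  have "tri ?A ?B ?C \<longleftrightarrow> card ?A = 4 * q \<and> card ?B = 4 * q \<and> card ?C = 4 * q \<and>
      card (?A \<inter> ?B) = 2 * q \<and> card (?A \<inter> ?C) = 2 * q \<and> card (?B \<inter> ?C) = 2 * q \<and> card (?A \<inter> ?B \<inter> ?C) = q"
    using True by (auto simp: tri_def adj_def vert_def)
  moreover have "code_triple n (4 * q) a b c \<longleftrightarrow> card ?A = 4 * q \<and> card ?B = 4 * q \<and> card ?C = 4 * q \<and>
      card (supp (a + b)) = 4 * q \<and> card (supp (a + c)) = 4 * q \<and> card (supp (b + c)) = 4 * q \<and>
      card (supp (a + (b + c))) = 4 * q"
    using True by (simp add: code_triple_def F2_iff hamming_wt_supp)
  ultimately show ?thesis
    unfolding w c four_q_cells by (simp only:)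
next
  case False
  then show ?thesis
    by (auto simp: code_triple_def F2_iff tri_def adj_def vert_def)
qed

section \<open>Links of the Johnson complex\<close>

lemma nonempty_subsets_123:
  assumes "T \<subseteq> {1..3::nat}" "T \<noteq> {}"
  shows "T = {1} \<or> T = {2} \<or> T = {3} \<or> T = {1, 2} \<or> T = {1, 3} \<or> T = {2, 3} \<or> T = {1, 2, 3}"
proof -
  have "T \<in> Pow {1, 2, 3}" "T \<noteq> {}"
    using assms by (auto simp: subset_iff)
  then show ?thesis
    unfolding Pow_insert Pow_empty image_insert image_empty
    by (elim UnE insertE emptyE) (simp_all, argo+)
qed

lemma johnson_top_faces_eq:
  assumes k: "\<epsilon> * real n = real k"
  shows "johnson_top_faces \<epsilon> n = {{x, x + a, x + b, x + c} |x a b c.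
    x \<in> F2 n \<and> even (hamming_wt x) \<and> code_triple n k a b c}" (is "_ = ?R")
proof (intro equalityI subsetI)
  fix t assume "t \<in> johnson_top_faces \<epsilon> n"
  then obtain x and s :: "nat \<Rightarrow> nat \<Rightarrow> bit" where t: "t = {x, x + s 1, x + s 2, x + s 3}"
      "x \<in> F2 n" "even (hamming_wt x)" "\<forall>i\<in>{1..3}. s i \<in> slice \<epsilon> n"
      and "\<forall>T. T \<subseteq> {1..3} \<and> T \<noteq> {} \<longrightarrow> real (hamming_wt (\<Sum>i\<in>T. s i)) = \<epsilon> * real n"
    unfolding johnson_top_faces_def by (elim CollectE exE conjE) (rule that)
  then have w: "T \<subseteq> {1..3} \<Longrightarrow> T \<noteq> {} \<Longrightarrow> real (hamming_wt (\<Sum>i\<in>T. s i)) = \<epsilon> * real n" for T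
    by simp
  have "s 1 \<in> F2 n" "s 2 \<in> F2 n" "s 3 \<in> F2 n"
    using t(4) by (auto simp: slice_def)
  then have "code_triple n k (s 1) (s 2) (s 3)"
    using w[of "{1}"] w[of "{2}"] w[of "{3}"] w[of "{1,2}"] w[of "{1,3}"] w[of "{2,3}"] w[of "{1,2,3}"]
    by (simp add: code_triple_def k)
  with t show "t \<in> ?R"
    by blast
next
  fix t assume "t \<in> ?R"
  then obtain x a b c where t: "t = {x, x + a, x + b, x + c}" "x \<in> F2 n" "even (hamming_wt x)"
      "code_triple n k a b c"
    by blast
  define s :: "nat \<Rightarrow> nat \<Rightarrow> bit" where "s i = (if i = 1 then a else if i = 2 then b else c)" for i
  have s: "s 1 = a" "s 2 = b" "s 3 = c"
    by (simp_all add: s_def)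
  have w: "real (hamming_wt (\<Sum>i\<in>T. s i)) = \<epsilon> * real n" if "T \<subseteq> {1..3} \<and> T \<noteq> {}" for T
    using nonempty_subsets_123[of T] that t(4) s unfolding code_triple_def k by auto
  have "s i \<in> slice \<epsilon> n" if "i \<in> {1..3}" for i
  proof -
    have "s i \<in> F2 n"
      using t(4) by (simp add: s_def code_triple_def)
    then show ?thesis
      using w[of "{i}"] that by (simp add: slice_def)
  qed
  with t w s show "t \<in> johnson_top_faces \<epsilon> n"
    unfolding johnson_top_faces_def
    by (intro CollectI exI[of _ x] exI[of _ s] conjI ballI allI impI) simp_all
qed

context johnson_link
begin

lemma adj_neq: "adj A B \<Longrightarrow> A \<noteq> B"
  using q_pos unfolding adj_def vert_def by force

lemma tri_distinct:
  assumes "tri A B C"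
  shows "A \<noteq> B" "A \<noteq> C" "B \<noteq> C"
  using assms adj_neq[of A B] adj_neq[of A C] adj_neq[of B C] unfolding tri_def by blast+

text \<open>\<open>A\<close>, \<open>B\<close>, \<open>C\<close> are the supports of the differences
  from \<open>v\<close>, so every link is a translate of the link of zero.\<close>

definition link_triangles :: "(nat \<Rightarrow> bit) \<Rightarrow> (nat \<Rightarrow> bit) set set" where
  "link_triangles v = {{v + vec A, v + vec B, v + vec C} |A B C. tri A B C}"

lemma code_triple_nonzero:
  assumes "code_triple n (4 * q) a b c"
  shows "a \<noteq> 0" "b \<noteq> 0" "c \<noteq> 0"
  using assms q_pos by (auto simp: code_triple_def hamming_wt_def)

lemma link_triangle_of_code_triple:
  assumes "code_triple n (4 * q) a b c"
  shows "{v, v + a, v + b, v + c} - {v} \<in> link_triangles v"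
proof -
  have "{v, v + a, v + b, v + c} - {v} = {v + a, v + b, v + c}"
    using code_triple_nonzero[OF assms] by auto
  then show ?thesis
    using assms[unfolded code_triple_iff_tri] unfolding link_triangles_def
    by (intro CollectI exI[of _ "supp a"] exI[of _ "supp b"] exI[of _ "supp c"]) simp
qed

text \<open>Any of the four vertices of a top face can serve as its base, so the faces through
  \<open>v\<close> are those based at \<open>v\<close>. Deleting \<open>v\<close> is injective on
  them, and both conditioning and an injective map keep a uniform distribution uniform.\<close>

lemma link_johnson_complex:
  assumes k: "\<epsilon> * real n = real (4 * q)" and v: "v \<in> vertices (johnson_complex \<epsilon> n)"
    and ne: "johnson_top_faces \<epsilon> n \<noteq> {}"
  shows "link (johnson_complex \<epsilon> n) v = pmf_of_set (link_triangles v)"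
    and "finite (link_triangles v)" and "link_triangles v \<noteq> {}"
proof -
  let ?T = "johnson_top_faces \<epsilon> n \<inter> {t. v \<in> t}"
  note fin = finite_johnson_top_faces[of \<epsilon> n]
  have T: "?T \<noteq> {}"
    using v ne fin by (auto simp: vertices_def faces_def johnson_complex_def)
  have base: "\<exists>a b c. t = {v, v + a, v + b, v + c} \<and> v \<in> F2 n \<and> even (hamming_wt v) \<and>
      code_triple n (4 * q) a b c" if t: "t \<in> ?T" for t
  proof -
    obtain x a b c where t: "t = {x, x + a, x + b, x + c}" "x \<in> F2 n" "even (hamming_wt x)"
        "code_triple n (4 * q) a b c" "v \<in> t"
      using t unfolding johnson_top_faces_eq[OF k] by blast
    \<comment> \<open>Rebasing at the vertex \<open>x + a\<close>; the vertices \<open>x + b\<close>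
      and \<open>x + c\<close> are reduced to this case by permuting the differences.\<close>
    have step: ?thesis if "v = x + a" "t = {x, x + a, x + b, x + c}" "code_triple n (4 * q) a b c" for a b c
    proof -
      have x: "x = v + a" "x + b = v + (a + b)" "x + c = v + (a + c)"
        using that(1) by (simp_all add: ac_simps)
      have "t = {v, v + a, v + (a + b), v + (a + c)}"
        using that(1,2) x by auto
      moreover have "a \<in> F2 n" "even (hamming_wt a)"
        using that(3) by (simp_all add: code_triple_def)
      moreover from this have "v \<in> F2 n" "even (hamming_wt v)"
        using t(2,3) that(1) F2_add[of x n a] even_hamming_wt_add[of x n a] by simp_all
      ultimately show ?thesis
        using code_triple_shift[OF that(3)]
        by (intro exI[of _ a] exI[of _ "a + b"] exI[of _ "a + c"] conjI)
    qed
    from t(5) consider "v = x" | "v = x + a" | "v = x + b" | "v = x + c"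
      unfolding t(1) by blast
    then show ?thesis
    proof cases
      case 1 with t show ?thesis by (intro exI[of _ a] exI[of _ b] exI[of _ c]) simp
    next
      case 2 then show ?thesis by (rule step[OF _ t(1,4)])
    next
      case 3
      moreover have "t = {x, x + b, x + a, x + c}" using t(1) by auto
      ultimately show ?thesis by (rule step[OF _ _ code_triple_swap(1)[OF t(4)]])
    next
      case 4
      moreover have "t = {x, x + c, x + a, x + b}" using t(1) by auto
      ultimately show ?thesis by (rule step[OF _ _ code_triple_swap(1)[OF code_triple_swap(2)[OF t(4)]]])
    qed
  qed
  have vF: "v \<in> F2 n" "even (hamming_wt v)"
  proof -
    obtain t where "t \<in> ?T" using T by blast
    from base[OF this] show "v \<in> F2 n" "even (hamming_wt v)"
      by blast+
  qed
  have img: "(\<lambda>t. t - {v}) ` ?T = link_triangles v"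
  proof (intro equalityI subsetI)
    fix u assume "u \<in> (\<lambda>t. t - {v}) ` ?T"
    then obtain t where t: "t \<in> ?T" "u = t - {v}" by blast
    from base[OF t(1)] obtain a b c where "t = {v, v + a, v + b, v + c}" "code_triple n (4 * q) a b c"
      by (elim exE conjE) (rule that)
    with t(2) show "u \<in> link_triangles v"
      using link_triangle_of_code_triple[of a b c v] by simp
  next
    fix u assume "u \<in> link_triangles v"
    then obtain A B C where u: "u = {v + vec A, v + vec B, v + vec C}" "tri A B C"
      unfolding link_triangles_def by blast
    then have ct: "code_triple n (4 * q) (vec A) (vec B) (vec C)"
      by (simp add: code_triple_iff_tri)
    then have "insert v u \<in> ?T"
      using vF unfolding johnson_top_faces_eq[OF k] u(1)
      by (intro IntI CollectI exI[of _ v] exI[of _ "vec A"] exI[of _ "vec B"] exI[of _ "vec C"]) simp_all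
    moreover have "u = insert v u - {v}"
      using code_triple_nonzero[OF ct] u(1) by auto
    ultimately show "u \<in> (\<lambda>t. t - {v}) ` ?T"
      by (rule rev_image_eqI)
  qed
  have inj: "inj_on (\<lambda>t. t - {v}) ?T"
    by (rule inj_onI) (metis IntD2 insert_Diff mem_Collect_eq)
  show "link (johnson_complex \<epsilon> n) v = pmf_of_set (link_triangles v)"
    unfolding link_def johnson_complex_def cond_pmf_pmf_of_set[OF fin T]
    using map_pmf_of_set_inj[OF inj T] fin img by simp
  show "finite (link_triangles v)" "link_triangles v \<noteq> {}"
    unfolding img[symmetric] using fin T by auto
qed

lemma card_link_triangles: "\<forall>t\<in>link_triangles v. card t = 3"
  using tri_distinct by (auto simp: link_triangles_def)

lemma ordered_link_triangles:
  "ordered_triangles (link_triangles v) = {[v + vec A, v + vec B, v + vec C] |A B C. tri A B C}"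
proof (intro equalityI subsetI)
  fix s assume "s \<in> ordered_triangles (link_triangles v)"
  then obtain x y z A B C where s: "s = [x, y, z]" "distinct [x, y, z]"
      "{x, y, z} = {v + vec A, v + vec B, v + vec C}" "tri A B C"
    unfolding ordered_triangles_def link_triangles_def using length_3_conv[of s] by auto
  have "x = v + vec A \<or> x = v + vec B \<or> x = v + vec C" "y = v + vec A \<or> y = v + vec B \<or> y = v + vec C"
     "z = v + vec A \<or> z = v + vec B \<or> z = v + vec C"
    using s(3) by blast+
  moreover have "tri A C B" "tri B A C" "tri B C A" "tri C A B" "tri C B A"
    using s(4) tri_swap by blast+
  ultimately have "\<exists>A B C. x = v + vec A \<and> y = v + vec B \<and> z = v + vec C \<and> tri A B C"
    using s(2,4) by (elim disjE) simp_all
  with s(1) show "s \<in> {[v + vec A, v + vec B, v + vec C] |A B C. tri A B C}"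
    by blast
next
  fix s assume "s \<in> {[v + vec A, v + vec B, v + vec C] |A B C. tri A B C}"
  then show "s \<in> ordered_triangles (link_triangles v)"
    using tri_distinct by (fastforce simp: ordered_triangles_def link_triangles_def)
qed

section \<open>The symmetric group acting on ordered triangles\<close>

lemma tri_image:
  assumes "\<pi> permutes {..<n}"
  shows "tri (\<pi> ` A) (\<pi> ` B) (\<pi> ` C) \<longleftrightarrow> tri A B C"
proof -
  have inj: "inj \<pi>"
    using assms by (rule permutes_inj)
  have c: "card (\<pi> ` X) = card X" for X
    using inj by (simp add: card_image inj_on_subset)
  have "\<pi> ` X \<subseteq> {..<n} \<longleftrightarrow> X \<subseteq> {..<n}" for X
    using permutes_in_image[OF assms] by blast
  then show ?thesis
    by (simp add: tri_def adj_def vert_def c flip: image_Int[OF inj])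
qed

text \<open>The intersection sizes prescribed for a triangle determine all its Venn cells, which is
  why the ordered triangles form a single orbit.\<close>

lemma tri_cells:
  assumes "tri A B C"
  shows "cell_card A B C {..<n} c = (if c = (False, False, False) then n - 7 * q else q)"
proof -
  have v: "vert A" "vert B" "vert C"
    using assms by (auto simp: tri_def adj_def)
  obtain c1 c2 c3 c4 c5 c6 c7 c8 where c:
    "cell_card A B C {..<n} (True,True,True) = c1"
    "cell_card A B C {..<n} (True,True,False) = c2"
    "cell_card A B C {..<n} (True,False,True) = c3"
    "cell_card A B C {..<n} (True,False,False) = c4"
    "cell_card A B C {..<n} (False,True,True) = c5"
    "cell_card A B C {..<n} (False,True,False) = c6"
    "cell_card A B C {..<n} (False,False,True) = c7"
    "cell_card A B C {..<n} (False,False,False) = c8"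
    and e: "c1+c2+c3+c4 = 4 * q" "c1+c2+c5+c6 = 4 * q" "c1+c3+c5+c7 = 4 * q"
    "card (A \<inter> B) = c1+c2" "card (A \<inter> C) = c1+c3" "card (B \<inter> C) = c1+c5"
    "card (A \<inter> B \<inter> C) = c1" "c1+c2+c3+c4+c5+c6+c7+c8 = n"
    by (rule cells_of_verts[OF v])
  have "c1 = q" "c1+c2 = 2 * q" "c1+c3 = 2 * q" "c1+c5 = 2 * q"
    using assms e by (simp_all add: tri_def adj_def)
  then have "c1 = q" "c2 = q" "c3 = q" "c4 = q" "c5 = q" "c6 = q" "c7 = q" "c8 = n - 7 * q"
    using e by linarith+
  note c = c[unfolded this]
  obtain x y z where "c = (x, y, z)"
    by (cases c)
  with c show ?thesis
    by (cases x; cases y; cases z; simp)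
qed

text \<open>Both colourings by \<open>cell\<close> take each value equally often, so some
  permutation of the coordinates matches them and carries each set to its counterpart.\<close>

lemma tri_transitive:
  assumes t: "tri A B C" and t': "tri A' B' C'"
  obtains \<pi> where "\<pi> permutes {..<n}" "\<pi> ` A = A'" "\<pi> ` B = B'" "\<pi> ` C = C'"
proof -
  have "image_mset (cell A B C) (mset_set {..<n}) = image_mset (cell A' B' C') (mset_set {..<n})"
  proof (rule multiset_eqI)
    fix c
    have "card {i \<in> {..<n}. cell A B C i = c} = card {i \<in> {..<n}. cell A' B' C' i = c}"
      using tri_cells[OF t, of c] tri_cells[OF t', of c] unfolding cell_card_def by (rule trans[OF _ sym])
    then show "count (image_mset (cell A B C) (mset_set {..<n})) c =
        count (image_mset (cell A' B' C') (mset_set {..<n})) c"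
      by (simp only: count_image_mset_eq_card_vimage finite_lessThan)
  qed
  then obtain \<pi> where \<pi>: "\<pi> permutes {..<n}" "\<forall>i\<in>{..<n}. cell A B C i = cell A' B' C' (\<pi> i)"
    using image_mset_eq_implies_permutes[of "{..<n}"] by (metis finite_lessThan)
  have sub: "X \<subseteq> {..<n}" if "X \<in> {A, B, C, A', B', C'}" for X
    using that t t' by (auto simp: tri_def adj_def vert_def)
  have img: "\<pi> ` X = X'" if "X \<subseteq> {..<n}" "X' \<subseteq> {..<n}" "\<forall>i\<in>{..<n}. i \<in> X \<longleftrightarrow> \<pi> i \<in> X'" for X X'
  proof (intro equalityI subsetI)
    fix j assume "j \<in> X'"
    then have "j \<in> \<pi> ` {..<n}"
      using that(2) permutes_image[OF \<pi>(1)] by auto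
    with \<open>j \<in> X'\<close> that(3) show "j \<in> \<pi> ` X"
      by auto
  qed (use that in auto)
  show thesis
    using \<pi> sub by (intro that[of \<pi>] img) (auto simp: cell_def)
qed

definition embed :: "(nat \<Rightarrow> bit) \<Rightarrow> (nat \<Rightarrow> nat) \<Rightarrow> nat set \<times> nat set \<times> nat set \<Rightarrow> (nat \<Rightarrow> bit) list" where
  "embed v \<pi> = (\<lambda>(A, B, C). [v + vec (\<pi> ` A), v + vec (\<pi> ` B), v + vec (\<pi> ` C)])"

lemma bij_betw_embed:
  assumes "\<pi> permutes {..<n}"
  shows "bij_betw (embed v \<pi>) {(A, B, C). tri A B C} (ordered_triangles (link_triangles v))"
proof -
  have inj: "inj \<pi>"
    using assms by (rule permutes_inj)
  have "inj_on (embed v \<pi>) {(A, B, C). tri A B C}"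
    by (auto simp: inj_on_def embed_def inj_image_eq_iff[OF inj])
  moreover have "embed v \<pi> ` {(A, B, C). tri A B C} = ordered_triangles (link_triangles v)"
    unfolding ordered_link_triangles
  proof (intro equalityI subsetI)
    fix s assume "s \<in> {[v + vec A, v + vec B, v + vec C] |A B C. tri A B C}"
    then obtain A B C where s: "s = [v + vec A, v + vec B, v + vec C]" "tri A B C"
      by blast
    have e: "\<pi> ` (inv_into UNIV \<pi> ` X) = X" for X
      using permutes_surj[OF assms] by (simp add: image_f_inv_f)
    have "tri (inv_into UNIV \<pi> ` A) (inv_into UNIV \<pi> ` B) (inv_into UNIV \<pi> ` C)"
      using s(2) tri_image[OF permutes_inv[OF assms]] by simp
    moreover have "s = embed v \<pi> (inv_into UNIV \<pi> ` A, inv_into UNIV \<pi> ` B, inv_into UNIV \<pi> ` C)"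
      by (simp add: embed_def e s(1))
    ultimately show "s \<in> embed v \<pi> ` {(A, B, C). tri A B C}"
      by blast
  qed (use tri_image[OF assms] in \<open>auto simp: embed_def\<close>)
  ultimately show ?thesis
    by (simp add: bij_betw_def)
qed

text \<open>Composition with a permutation carrying \<open>t\<close> to \<open>u\<close> injects the
  permutations that place \<open>s\<close> at \<open>t\<close> into those that place it at
  \<open>u\<close>. Hence all these fibres have the same size, and they partition the
  permutations.\<close>

lemma embed_uniform:
  assumes fin: "finite (link_triangles v)"
    and s: "s \<in> {(A, B, C). tri A B C}" and t: "t \<in> ordered_triangles (link_triangles v)"
  shows "card {\<pi> \<in> {\<pi>. \<pi> permutes {..<n}}. embed v \<pi> s = t} * card (ordered_triangles (link_triangles v)) =
    card {\<pi>. \<pi> permutes {..<n}}"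
proof -
  let ?I = "{\<pi>. \<pi> permutes {..<n}}" and ?E = "ordered_triangles (link_triangles v)"
  have finI: "finite ?I"
    by (simp add: finite_permutations)
  have finE: "finite ?E"
    using fin card_link_triangles by (rule finite_ordered_triangles)
  have le: "card {\<pi> \<in> ?I. embed v \<pi> s = t} \<le> card {\<pi> \<in> ?I. embed v \<pi> s = u}"
    if t: "t \<in> ?E" and u: "u \<in> ?E" for t u
  proof -
    obtain A B C where tA: "t = [v + vec A, v + vec B, v + vec C]" "tri A B C"
      using t unfolding ordered_link_triangles by blast
    obtain A' B' C' where uA: "u = [v + vec A', v + vec B', v + vec C']" "tri A' B' C'"
      using u unfolding ordered_link_triangles by blast
    obtain \<rho> where \<rho>: "\<rho> permutes {..<n}" "\<rho> ` A = A'" "\<rho> ` B = B'" "\<rho> ` C = C'"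
      using tri_transitive[OF tA(2) uA(2)] by blast
    have "(\<circ>) \<rho> ` {\<pi> \<in> ?I. embed v \<pi> s = t} \<subseteq> {\<pi> \<in> ?I. embed v \<pi> s = u}"
      using \<rho> permutes_compose[of _ "{..<n}" \<rho>] by (cases s) (auto simp: embed_def tA uA image_comp[symmetric])
    moreover have "inj_on ((\<circ>) \<rho>) {\<pi> \<in> ?I. embed v \<pi> s = t}"
      by (rule inj_on_subset[OF fun.inj_map[OF permutes_inj[OF \<rho>(1)]] subset_UNIV])
    ultimately show ?thesis
      using finI by (intro card_inj_on_le) auto
  qed
  have "?I = (\<Union>u\<in>?E. {\<pi> \<in> ?I. embed v \<pi> s = u})"
    using bij_betwE[OF bij_betw_embed[of _ v]] s by blast
  then have "card ?I = card (\<Union>u\<in>?E. {\<pi> \<in> ?I. embed v \<pi> s = u})"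
    by (rule arg_cong)
  also have "\<dots> = (\<Sum>u\<in>?E. card {\<pi> \<in> ?I. embed v \<pi> s = u})"
    using finE finI by (intro card_UN_disjoint) auto
  also have "\<dots> = (\<Sum>u\<in>?E. card {\<pi> \<in> ?I. embed v \<pi> s = t})"
    using le t by (intro sum.cong refl antisym) auto
  finally show ?thesis
    by simp
qed

text \<open>A common neighbour of the edge, followed by a filler, gives the triangle. It transfers
  the cochain conditions, available on faces of the complex, to all adjacent pairs.\<close>

lemma adj_extends:
  assumes "adj A B"
  obtains C where "tri A B C"
proof -
  have "vert A" using assms by (simp add: adj_def)
  then obtain Z where "adj A Z" "adj B Z"
    using common_balanced_exists assms by metis
  then show thesis
    using filler_exists[of A B Z] assms that by blast
qed

end

section \<open>Coboundary expansion\<close>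

text \<open>Each permutation turns the cone based at \<open>A0\<close> into a candidate
  \<open>h \<pi>\<close>. If its coboundary differs from \<open>f\<close> on an edge, one of at most
  27 triangles has nontrivial coboundary, and \<open>averaging\<close> selects a good
  permutation.\<close>

lemma (in johnson_link) link_coboundary_expander:
  assumes fin: "finite (link_triangles v)" and ne: "link_triangles v \<noteq> {}"
  shows "coboundary_expander1 TYPE('g) (1 / 85) (pmf_of_set (link_triangles v))"
  unfolding coboundary_expander1_def
proof (intro allI impI ballI)
  fix \<Gamma> :: "'g monoid" and f
  let ?X = "pmf_of_set (link_triangles v)" and ?E = "ordered_triangles (link_triangles v)"
  let ?I = "{\<pi>. \<pi> permutes {..<n}}" and ?D = "{(A, B, C). tri A B C}"
  assume "group \<Gamma>" and f: "f \<in> cochains1 ?X \<Gamma>"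
  then interpret group \<Gamma>
    by simp
  interpret johnson_link_cochains n q \<Gamma> ..
  obtain A0 B0 C0 where "tri A0 B0 C0"
    using ne unfolding link_triangles_def by blast
  then have vA0: "vert A0"
    by (simp add: tri_def adj_def)
  define c where "c B = (SOME B'. balanced A0 B B')" for B
  have c: "balanced A0 B (c B)" if "adj B C" for B C
    unfolding c_def using common_balanced_exists[OF vA0 that] by (metis someI)
  define F where "F \<pi> A B = f [v + vec (\<pi> ` A), v + vec (\<pi> ` B)]" for \<pi> :: "nat \<Rightarrow> nat" and A B
  define H where "H \<pi> A = F \<pi> A (c A) \<otimes>\<^bsub>\<Gamma>\<^esub> F \<pi> (c A) A0" for \<pi> A
  \<comment> \<open>Adding \<open>v\<close> undoes the translation in characteristic two, and the
    preimage undoes \<open>\<pi>\<close>.\<close>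
  define h where "h \<pi> x = H \<pi> (\<pi> -` supp (v + x))" for \<pi> x
  have h: "h \<pi> (v + vec (\<pi> ` A)) = H \<pi> A" if "\<pi> \<in> ?I" for \<pi> A
    using that by (simp add: h_def inj_vimage_image_eq permutes_inj)
  have edge: "[v + vec A, v + vec B] \<in> directed_faces ?X 1" if "tri A B C" for A B C
  proof -
    have "{v + vec A, v + vec B, v + vec C} \<in> link_triangles v"
      using that unfolding link_triangles_def by blast
    then have "{v + vec A, v + vec B} \<in> faces ?X"
      unfolding faces_def set_pmf_of_set[OF ne fin] by blast
    then show ?thesis
      using tri_distinct(1)[OF that] by (simp add: directed_faces_def)
  qed
  have F: "cochain (F \<pi>)" if \<pi>: "\<pi> \<in> ?I" for \<pi>
    unfolding cochain_def
  proof (intro allI impI)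
    fix A B assume "adj A B"
    then obtain C where "tri A B C"
      by (rule adj_extends)
    then have "tri (\<pi> ` A) (\<pi> ` B) (\<pi> ` C)"
      using tri_image \<pi> by simp
    from edge[OF this] f show "F \<pi> A B \<in> carrier \<Gamma> \<and> F \<pi> A B = inv\<^bsub>\<Gamma>\<^esub> F \<pi> B A"
      unfolding cochains1_def F_def by blast
  qed
  define Q where "Q s G \<longleftrightarrow> (case s of (A, B, C) \<Rightarrow> G A B = (G A (c A) \<otimes>\<^bsub>\<Gamma>\<^esub> G (c A) A0) \<otimes>\<^bsub>\<Gamma>\<^esub>
      inv\<^bsub>\<Gamma>\<^esub> (G B (c B) \<otimes>\<^bsub>\<Gamma>\<^esub> G (c B) A0))"
    for s :: "nat set \<times> nat set \<times> nat set" and G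
  have "\<exists>S. S \<subseteq> ?D \<and> card S \<le> 27 \<and> (\<forall>G. cochain G \<longrightarrow> (\<forall>t\<in>S. closed_on G t) \<longrightarrow> Q s G)"
    if sD: "s \<in> ?D" for s
  proof -
    obtain A B C where s: "s = (A, B, C)" "tri A B C"
      using sD by auto
    then have "adj A B" "adj B A"
      using adj_commute by (auto simp: tri_def)
    then have "forced 27 (Q s)"
      unfolding Q_def s(1) prod.case by (intro forced_edge vA0 c)
    then obtain S where S: "card S \<le> 27" "\<forall>(A, B, C)\<in>S. tri A B C"
      "\<forall>G. cochain G \<longrightarrow> (\<forall>t\<in>S. closed_on G t) \<longrightarrow> Q s G"
      unfolding forced_def by (elim exE conjE) (rule that)
    have "S \<subseteq> ?D"
      using S(2) by blast
    with S show ?thesis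
      by (intro exI[of _ S] conjI)
  qed
  then have "\<forall>s\<in>?D. \<exists>S. S \<subseteq> ?D \<and> card S \<le> 27 \<and>
      (\<forall>G. cochain G \<longrightarrow> (\<forall>t\<in>S. closed_on G t) \<longrightarrow> Q s G)"
    by (rule ballI)
  \<comment> \<open>The sets \<open>S s\<close> do not depend on \<open>\<pi>\<close> or on the
    cochain, as \<open>averaging\<close> requires.\<close>
  from bchoice[OF this] obtain S where S: "\<forall>s\<in>?D. S s \<subseteq> ?D \<and> card (S s) \<le> 27 \<and>
      (\<forall>G. cochain G \<longrightarrow> (\<forall>t\<in>S s. closed_on G t) \<longrightarrow> Q s G)"
    by (rule exE)
  have closed: "closed_on (F \<pi>) t \<longleftrightarrow> coboundary1 \<Gamma> f (embed v \<pi> t) = \<one>\<^bsub>\<Gamma>\<^esub>" for \<pi> t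
    by (cases t) (simp add: closed_on_def embed_def F_def)
  have finE: "finite ?E"
    using fin card_link_triangles by (rule finite_ordered_triangles)
  have id: "id \<in> ?I"
    by (simp add: permutes_id)
  have finD: "finite ?D"
    using bij_betw_finite[OF bij_betw_embed[of id v]] finE id by simp
  have "\<exists>\<pi>\<in>?I. card {t \<in> ?E. f (take 2 t) \<noteq> coboundary0 \<Gamma> (h \<pi>) (take 2 t)}
      \<le> 27 * card {t \<in> ?E. coboundary1 \<Gamma> f t \<noteq> \<one>\<^bsub>\<Gamma>\<^esub>}"
  proof (rule averaging[where \<psi> = "embed v" and S = S])
    show "finite ?I"
      by (simp add: finite_permutations)
    show "?I \<noteq> {}"
      using id by blast
    show "finite ?D" "finite ?E" by fact+
    show "bij_betw (embed v \<pi>) ?D ?E" if "\<pi> \<in> ?I" for \<pi>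
      using that by (intro bij_betw_embed) simp
    show "card {\<pi> \<in> ?I. embed v \<pi> s = t} * card ?E = card ?I" if "s \<in> ?D" "t \<in> ?E" for s t
      using embed_uniform[OF fin that] .
    show "S s \<subseteq> ?D" "card (S s) \<le> 27" if "s \<in> ?D" for s
      using S that by blast+
    fix \<pi> s assume \<pi>: "\<pi> \<in> ?I" and s: "s \<in> ?D"
      and cost: "f (take 2 (embed v \<pi> s)) \<noteq> coboundary0 \<Gamma> (h \<pi>) (take 2 (embed v \<pi> s))"
    show "\<exists>t\<in>S s. coboundary1 \<Gamma> f (embed v \<pi> t) \<noteq> \<one>\<^bsub>\<Gamma>\<^esub>"
    proof (rule ccontr)
      assume "\<not> ?thesis"
      then have *: "\<forall>t\<in>S s. closed_on (F \<pi>) t"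
        by (simp add: closed)
      obtain A B C where sA: "s = (A, B, C)"
        by (cases s)
      have "F \<pi> A B = H \<pi> A \<otimes>\<^bsub>\<Gamma>\<^esub> inv\<^bsub>\<Gamma>\<^esub> H \<pi> B"
        using bspec[OF S s] F[OF \<pi>] * by (simp add: sA H_def Q_def)
      with cost show False
        by (simp add: sA embed_def h[OF \<pi>] F_def)
    qed
  qed
  then obtain \<pi> where \<pi>: "\<pi> \<in> ?I" and
    le: "card {t \<in> ?E. f (take 2 t) \<noteq> coboundary0 \<Gamma> (h \<pi>) (take 2 t)}
      \<le> 27 * card {t \<in> ?E. coboundary1 \<Gamma> f t \<noteq> \<one>\<^bsub>\<Gamma>\<^esub>}"
    by blast
  have "h \<pi> \<in> cochains0 ?X \<Gamma>"
    unfolding cochains0_def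
  proof (intro CollectI ballI)
    fix x assume "x \<in> vertices ?X"
    then obtain t where "t \<in> link_triangles v" "x \<in> t"
      unfolding vertices_def faces_def set_pmf_of_set[OF ne fin] by auto
    then obtain A B C where x: "x = v + vec A \<or> x = v + vec B \<or> x = v + vec C" and t: "tri A B C"
      unfolding link_triangles_def by auto
    have "tri B A C" "tri C A B"
      using t tri_swap by blast+
    with x t obtain A B C where A: "x = v + vec A" and "tri A B C"
      by (elim disjE) (erule that; assumption)+
    have e: "\<pi> ` (inv_into UNIV \<pi> ` X) = X" for X
      using \<pi> permutes_surj[of \<pi> "{..<n}"] by (simp add: image_f_inv_f)
    define A' where "A' = inv_into UNIV \<pi> ` A"
    have "tri A' (inv_into UNIV \<pi> ` B) (inv_into UNIV \<pi> ` C)"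
      using \<open>tri A B C\<close> tri_image[OF permutes_inv, of \<pi>] \<pi> by (simp add: A'_def)
    \<comment> \<open>A vertex of the link lies in a triangle, so \<open>A'\<close> has a neighbour
      and the choice \<open>c A'\<close> is a genuine one.\<close>
    then have "balanced A0 A' (c A')"
      using c[of A'] unfolding tri_def by (elim conjE)
    then have "adj A' (c A')" "adj (c A') A0"
      using adj_commute by (auto simp: balanced_def)
    then have "H \<pi> A' \<in> carrier \<Gamma>"
      unfolding H_def using cochain_carrier[OF F[OF \<pi>]] by simp
    moreover have "h \<pi> x = H \<pi> A'"
      using h[OF \<pi>, of A'] by (simp add: A'_def e A)
    ultimately show "h \<pi> x \<in> carrier \<Gamma>"
      by simp
  qed
  moreover have "1 / 85 * cochain_dist ?X 1 f (coboundary0 \<Gamma> (h \<pi>)) \<le> cochain_wt ?X 2 \<Gamma> (coboundary1 \<Gamma> f)"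
  proof -
    let ?a = "real (card {t \<in> ?E. f (take 2 t) \<noteq> coboundary0 \<Gamma> (h \<pi>) (take 2 t)})"
      and ?b = "real (card {t \<in> ?E. coboundary1 \<Gamma> f t \<noteq> \<one>\<^bsub>\<Gamma>\<^esub>})"
    \<comment> \<open>The averaged cone gives the factor 27, and 27 is at most 85.\<close>
    have "1 / 85 * ?a \<le> ?b"
      using le by linarith
    then have "1 / 85 * ?a / real (card ?E) \<le> ?b / real (card ?E)"
      by (rule divide_right_mono) simp
    then show ?thesis
      unfolding cochain_dist_1[OF fin ne card_link_triangles] cochain_wt_2[OF fin ne card_link_triangles]
        times_divide_eq_right .
  qed
  ultimately show "\<exists>g\<in>cochains0 ?X \<Gamma>.
      1 / 85 * cochain_dist ?X 1 f (coboundary0 \<Gamma> g) \<le> cochain_wt ?X 2 \<Gamma> (coboundary1 \<Gamma> f)"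
    by blast
qed

text \<open>Without directed edges all distances of 1-cochains vanish, so the trivial 0-cochain
  works. This covers the degenerate case \<open>n = 0\<close>.\<close>

lemma coboundary_expander1_no_edges:
  fixes X :: "'v weighted_complex"
  assumes "directed_faces X 1 = {}"
  shows "coboundary_expander1 TYPE('g) \<beta> X"
  unfolding coboundary_expander1_def
proof (intro allI impI ballI)
  fix \<Gamma> :: "'g monoid" and f :: "'v list \<Rightarrow> 'g"
  assume "group \<Gamma>"
  then have "(\<lambda>_. \<one>\<^bsub>\<Gamma>\<^esub>) \<in> cochains0 X \<Gamma>"
    by (simp add: cochains0_def group.is_monoid monoid.one_closed)
  moreover have "cochain_dist X 1 f g = 0" for g
    using assms by (simp add: cochain_dist_def)
  ultimately show "\<exists>g\<in>cochains0 X \<Gamma>.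
      \<beta> * cochain_dist X 1 f (coboundary0 \<Gamma> g) \<le> cochain_wt X 2 \<Gamma> (coboundary1 \<Gamma> f)"
    by (intro bexI[of _ "\<lambda>_. \<one>\<^bsub>\<Gamma>\<^esub>"]) (simp_all add: cochain_wt_def cochain_dist_def)
qed

theorem theorem6p5:
  fixes n :: nat and \<epsilon> :: real
  assumes "0 < \<epsilon>" and "\<epsilon> \<le> 1 / 4"
    and "\<exists>m::nat. \<epsilon> * real n = 8 * real m"
  shows "\<forall>v\<in>vertices (johnson_complex \<epsilon> n).
           coboundary_expander1 TYPE('g) (1 / 85) (link (johnson_complex \<epsilon> n) v)"
proof
  fix v assume v: "v \<in> vertices (johnson_complex \<epsilon> n)"
  obtain m :: nat where m: "\<epsilon> * real n = 8 * real m"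
    using assms(3) by blast
  have ne: "johnson_top_faces \<epsilon> n \<noteq> {}"
    using assms(2) m by (rule johnson_top_faces_nonempty)
  show "coboundary_expander1 TYPE('g) (1 / 85) (link (johnson_complex \<epsilon> n) v)"
  proof (cases "m = 0")
    \<comment> \<open>Since \<open>\<epsilon>\<close> is positive, weight zero forces
      \<open>n = 0\<close>; then 0 is the only vector and the link has no edges.\<close>
    case True
    then have "n = 0"
      using m assms(1) by simp
    then have F2: "F2 n \<subseteq> {0}"
      by (auto simp: F2_def fun_eq_iff)
    have sub: "t \<subseteq> {0}" if "t \<in> johnson_top_faces \<epsilon> n" for t
    proof -
      have "\<epsilon> * real n = real 0"
        using m True by simp
      from that obtain x a b c where "t = {x, x + a, x + b, x + c}" "x \<in> F2 n" "code_triple n 0 a b c"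
        unfolding johnson_top_faces_eq[OF \<open>\<epsilon> * real n = real 0\<close>] by (elim CollectE exE conjE) (rule that)
      moreover from this have "x = 0" "a = 0" "b = 0" "c = 0"
        using F2 unfolding code_triple_def by blast+
      ultimately show ?thesis
        by simp
    qed
    have "directed_faces (link (johnson_complex \<epsilon> n) v) 1 = {}"
    proof (rule equals0I)
      fix s assume "s \<in> directed_faces (link (johnson_complex \<epsilon> n) v) 1"
      then have s: "length s = 2" "distinct s" "set s \<in> faces (link (johnson_complex \<epsilon> n) v)"
        by (simp_all add: directed_faces_def)
      then obtain t where "set s \<subseteq> t" "t \<in> johnson_top_faces \<epsilon> n"
        unfolding faces_link[OF v] using ne finite_johnson_top_faces[of \<epsilon> n]
        by (auto simp: faces_def johnson_complex_def)
      then have "set s \<subseteq> {0}"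
        using sub by blast
      then have "card (set s) \<le> 1"
        using card_mono[of "{0}" "set s"] by simp
      then show False
        using s(1,2) distinct_card[of s] by simp
    qed
    then show ?thesis
      by (rule coboundary_expander1_no_edges)
  next
    case False
    have "real (32 * m) \<le> real n"
      using mult_right_mono[OF assms(2), of "real n"] m by simp
    \<comment> \<open>The weight \<open>8 * m\<close> equals \<open>4 * q\<close> for
      \<open>q = 2 * m\<close>, and \<open>\<epsilon> \<le> 1 / 4\<close> becomes
      \<open>16 * q \<le> n\<close>.\<close>
    then interpret johnson_link n "2 * m"
      using False by unfold_locales linarith+
    have k: "\<epsilon> * real n = real (4 * (2 * m))"
      using m by simp
    show ?thesis
      using link_coboundary_expander[OF link_johnson_complex(2,3)[OF k v ne]]
      unfolding link_johnson_complex(1)[OF k v ne] .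
  qed
qed

end
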